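(* Let $q$ be an odd prime power, $p$ its characteristic, and let $1\le n\le q^2-2$. Write $n=u+vq$ with $0\le u,v\le q-1$, and write $3n\equiv u'+v'q\pmod{q^2-1}$ with $0\le u',v'\le q-1$ and $u'+v'q>0$. Then in $\mathbb F_q$ (integers interpreted in $\mathbb F_p$, and $2^{-1}$ the inverse of $2$ in $\mathbb F_p$), \[ \sum_{a\in\mathbb F_q}D_n(1,a)^3=3(-\delta_n-\mathrm{I}-\mathrm{II}+\mathrm{III})+ \begin{cases}\displaystyle -2^{-u'-v'}\binom{u'+v'}{q-1}+\binom{2(q-1)-u'-v'}{q-1-u'}&\text{if } 1\le u'+v'q\le q^2-2,\\[2mm] -1&\text{if } u'+v'q=q^2-1,\end{cases} \] where $\mathrm{I},\mathrm{II},\mathrm{III}$ are defined (in terms of $u,v,q$) as follows, all sums being over integers in the indicated ranges: \[ \mathrm{I}=\sum_{\max\{-1,\,v-q+\frac{u+v}{q-1}\}<s\le v-q+\frac{u+v}{q-1}+1}\binom{u+v-(s-v+q-1)(q-1)}{(s-2v+2q)(q-1)-2(u+v)}, \] \[ \mathrm{II}=\sum_{\substack{0\le s\le 2\\ \max\{0,\,v-s+\frac{u+v}{q-1}\}<\alpha\le\min\{q-1,\,v-s+\frac{u+v}{q-1}+1\}}}\binom{u+v-(s+\alpha-v-1)(q-1)}{(s+2\alpha-2v)(q-1)-2(u+v)}, \] \[ \mathrm{III}=\sum_{\substack{-1\le s\le 1\\ \max\{s-\frac{u+v}{q-1},\,v-q+1\}\le\epsilon<\min\{s-\frac{u+v}{q-1}+1,\,v\}}}(-1)^{v+\epsilon}\binom{u+2v-(s-\epsilon)(q-1)-\epsilon}{(s-2\epsilon+1)(q-1)-2u-v-\epsilon}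 -\sum_{\max\{-2,\,v-q+\frac{u+v}{q-1}\}<s\le\min\{1,\,v-q+\frac{u+v}{q-1}+1\}}\binom{u+v-(s-v+q-1)(q-1)}{(s-2v+2q)(q-1)-2(u+v)}. \]
   Context: For an integer $n\ge 0$, the $n$th reversed Dickson polynomial $D_n(1,x)\in\mathbb Z[x]$ is defined by $D_n(1,x(1-x))=x^n+(1-x)^n$, regarded over $\mathbb F_q$ by reducing coefficients. $\delta_n=1$ if $n\equiv 0\pmod{q-1}$ and $\delta_n=0$ otherwise. For integers $m\ge 0$ and $k$, $\binom mk$ is the usual binomial coefficient, taken to be $0$ unless $0\le k\le m$. *)

theory Defs
  imports "HOL-Computational_Algebra.Polynomial" "HOL-Library.Cardinality"
begin

definition rev_dickson :: "nat \<Rightarrow> int poly" where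
  "rev_dickson n = (THE P. pcompose P [:0, 1, -1:] = [:0, 1:] ^ n + [:1, -1:] ^ n)"

definition rev_dickson_eval :: "nat \<Rightarrow> 'a::comm_ring_1 \<Rightarrow> 'a" where
  "rev_dickson_eval n a = poly (map_poly of_int (rev_dickson n)) a"

definition binom_int :: "int \<Rightarrow> int \<Rightarrow> int" where
  "binom_int m k = (if 0 \<le> k \<and> k \<le> m then int (nat m choose nat k) else 0)"

definition termI :: "int \<Rightarrow> int \<Rightarrow> int \<Rightarrow> int \<Rightarrow> int" where
  "termI q u v s = binom_int (u + v - (s - v + q - 1) * (q - 1)) ((s - 2*v + 2*q) * (q - 1) - 2 * (u + v))"

definition ratio :: "int \<Rightarrow> int \<Rightarrow> int \<Rightarrow> rat" where
  "ratio q u v = of_int (u + v) / of_int (q - 1)"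

definition sumI :: "int \<Rightarrow> int \<Rightarrow> int \<Rightarrow> int" where
  "sumI q u v = (let w = ratio q u v in
     (\<Sum>s\<in>{s::int. max (-1) (of_int v - of_int q + w) < of_int s \<and> of_int s \<le> of_int v - of_int q + w + 1}.
        termI q u v s))"

definition sumII :: "int \<Rightarrow> int \<Rightarrow> int \<Rightarrow> int" where
  "sumII q u v = (let w = ratio q u v in
     (\<Sum>(s, \<alpha>)\<in>{(s::int, \<alpha>::int). 0 \<le> s \<and> s \<le> 2 \<and>
         max 0 (of_int v - of_int s + w) < of_int \<alpha> \<and> of_int \<alpha> \<le> min (of_int q - 1) (of_int v - of_int s + w + 1)}.
        binom_int (u + v - (s + \<alpha> - v - 1) * (q - 1)) ((s + 2*\<alpha> - 2*v) * (q - 1) - 2 * (u + v))))"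

definition sumIII :: "int \<Rightarrow> int \<Rightarrow> int \<Rightarrow> int" where
  "sumIII q u v = (let w = ratio q u v in
     (\<Sum>(s, \<epsilon>)\<in>{(s::int, \<epsilon>::int). -1 \<le> s \<and> s \<le> 1 \<and>
         max (of_int s - w) (of_int v - of_int q + 1) \<le> of_int \<epsilon> \<and> of_int \<epsilon> < min (of_int s - w + 1) (of_int v)}.
        (-1) ^ nat \<bar>v + \<epsilon>\<bar> *
        binom_int (u + 2*v - (s - \<epsilon>) * (q - 1) - \<epsilon>) ((s - 2*\<epsilon> + 1) * (q - 1) - 2*u - v - \<epsilon>))
   - (\<Sum>s\<in>{s::int. max (-2) (of_int v - of_int q + w) < of_int s \<and> of_int s \<le> min 1 (of_int v - of_int q + w + 1)}.
        termI q u v s))"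

definition delta :: "nat \<Rightarrow> nat \<Rightarrow> nat" where
  "delta q n = (if n mod (q - 1) = 0 then 1 else 0)"

end

theory Submission
  imports Defs "HOL-Number_Theory.Cong"
begin

text \<open>
  Since the cube of the Dickson polynomial, composed with \<open>X (1 - X)\<close>, is
  \<open>X^3n + (1 - X)^3n + 3 (X (1 - X))^n (X^n + (1 - X)^n)\<close>, it suffices to sum functions of
  \<open>x (1 - x)\<close>. Each element \<open>a\<close> of the field is \<open>x (1 - x)\<close> for two values of \<open>x\<close> (counting
  \<open>a = 1/4\<close> twice), which are either both in the field or both roots of \<open>h = X^q + X - 1\<close>. So
  twice the sum over \<open>a\<close> is the sum over the field plus the sum over the roots of \<open>h\<close>. The
  quadratic extension is avoided: the latter sum is the linear functional sending a polynomial to the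
  coefficient of \<open>X^(q-1)\<close> in its remainder modulo \<open>h\<close>, and expanding \<open>1/h\<close> at infinity
  turns it into a sum of ordinary coefficients. Modulo \<open>h\<close>, \<open>X^q\<close> is \<open>1 - X\<close> and
  \<open>(1 - X)^q\<close> is \<open>X\<close>, so exponents reduce to base-\<open>q\<close> digits. With
  \<open>n = r + m (q - 1)\<close> and \<open>0 \<le> r < q - 1\<close>, the sums I, II and III collapse to terms indexed by
  \<open>t = 0, 1, 2\<close> that depend only on \<open>q\<close>, \<open>r\<close>, \<open>m\<close>.
\<close>

subsection \<open>Reversed Dickson polynomials\<close>

lemma coeff_X_power_mult:
  "coeff ([:0, 1:] ^ a * p) k = (if a \<le> k then coeff p (k - a) else (0::'a::comm_semiring_1))"
  using coeff_monom_mult[of 1 a p k] by (auto simp: monom_altdef)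

lemma coeff_one_minus_X_power:
  "coeff ([:1, -1:] ^ b :: 'a::comm_ring_1 poly) k = (-1) ^ k * of_nat (b choose k)"
proof (cases "k \<le> b")
  case True
  then show ?thesis by (simp add: coeff_linear_poly_power mult.commute)
next
  case False
  have "degree ([:1, -1:] ^ b :: 'a poly) \<le> degree ([:1, -1:] :: 'a poly) * b"
    by (rule degree_power_le)
  also have "\<dots> \<le> b" by simp
  finally show ?thesis using False by (simp add: coeff_eq_0 binomial_eq_0)
qed

lemma coeff_X_one_minus_X:
  "coeff ([:0, 1:] ^ a * [:1, -1:] ^ b :: 'a::comm_ring_1 poly) k =
    (if a \<le> k then (-1) ^ (k - a) * of_nat (b choose (k - a)) else 0)"
  by (simp add: coeff_X_power_mult coeff_one_minus_X_power)

lemma degree_X_one_minus_X: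
  "degree ([:0, 1:] ^ a * [:1, -1:] ^ b :: 'a::comm_ring_1 poly) \<le> a + b"
  by (rule degree_le) (auto simp: coeff_X_one_minus_X binomial_eq_0)

text \<open>Since \<open>x + y = 1\<close>, power sums satisfy
  \<open>x^(m+2) + y^(m+2) = x^(m+1) + y^(m+1) - x y (x^m + y^m)\<close>. This yields the recurrence
  \<open>P - X Q\<close> with initial values 2 and 1.\<close>

lemma rev_dickson_exists:
  "\<exists>P :: int poly. pcompose P [:0, 1, -1:] = [:0, 1:] ^ n + [:1, -1:] ^ n"
proof (induction n rule: less_induct)
  case (less n)
  consider "n = 0" | "n = 1" | m where "n = m + 2"
    by (metis add_2_eq_Suc' One_nat_def not0_implies_Suc)
  then show ?case
  proof cases
    case 1
    then show ?thesis by (intro exI[of _ 2]) (simp add: numeral_poly)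
  next
    case 2
    then show ?thesis by (intro exI[of _ 1]) (simp add: pcompose_1 one_pCons)
  next
    case 3
    obtain P Q :: "int poly"
      where P: "pcompose P [:0, 1, -1:] = [:0, 1:] ^ (m + 1) + [:1, -1:] ^ (m + 1)"
        and Q: "pcompose Q [:0, 1, -1:] = [:0, 1:] ^ m + [:1, -1:] ^ m"
      using less[of "m + 1"] less[of m] 3 by auto
    define x y :: "int poly" where "x = [:0, 1:]" and "y = [:1, -1:]"
    have xy: "[:0, 1, -1:] = x * y" and y: "y = 1 - x"
      by (simp_all add: x_def y_def one_pCons)
    have pcompose_X: "pcompose [:0, 1:] R = R" for R :: "int poly"
      by (simp add: pcompose_pCons)
    have PQ: "pcompose P (x * y) = x ^ (m + 1) + y ^ (m + 1)" "pcompose Q (x * y) = x ^ m + y ^ m"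
      using P Q unfolding xy unfolding x_def y_def by blast+
    have "pcompose (P - x * Q) (x * y) = x ^ (m + 1) + y ^ (m + 1) - x * y * (x ^ m + y ^ m)"
      unfolding pcompose_diff pcompose_mult PQ by (simp only: x_def pcompose_X)
    also have "\<dots> = x ^ n + y ^ n"
      by (simp add: 3 y algebra_simps power2_eq_square)
    finally show ?thesis unfolding xy[symmetric] unfolding x_def y_def by blast
  qed
qed

text \<open>The definite description denotes because composition with the nonconstant
  \<open>X (1 - X)\<close> is injective on integer polynomials.\<close>

lemma pcompose_rev_dickson:
  "pcompose (rev_dickson n) [:0, 1, -1:] = [:0, 1:] ^ n + [:1, -1:] ^ n"
proof -
  have "P = Q" if "pcompose P [:0, 1, -1:] = pcompose Q [:0, 1, -1:]" for P Q :: "int poly"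
  proof -
    have pcompose_X: "pcompose [:0, 1:] R = R" for R :: "int poly"
      by (simp add: pcompose_pCons)
    have "pcompose (P - Q) [:0, 1, -1:] = 0" using that by (simp add: pcompose_diff)
    then show ?thesis by (simp add: pcompose_eq_0_iff)
  qed
  then have "\<exists>!P :: int poly. pcompose P [:0, 1, -1:] = [:0, 1:] ^ n + [:1, -1:] ^ n"
    using rev_dickson_exists[of n] by metis
  then show ?thesis unfolding rev_dickson_def by (rule theI')
qed

section \<open>Reduction of integer coefficients to the field\<close>

lemma map_poly_of_int_add:
  "map_poly of_int (p + q) = (map_poly of_int p + map_poly of_int q :: 'a::comm_ring_1 poly)"
  by (rule poly_eqI) (simp add: coeff_map_poly)

lemma map_poly_of_int_mult:
  "map_poly of_int (p * q) = (map_poly of_int p * map_poly of_int q :: 'a::comm_ring_1 poly)"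
  by (rule poly_eqI) (simp add: coeff_map_poly coeff_mult)

lemma map_poly_of_int_power:
  "map_poly of_int (p ^ n) = (map_poly of_int p ^ n :: 'a::comm_ring_1 poly)"
  by (induction n) (simp_all add: map_poly_of_int_mult)

lemma map_poly_of_int_pcompose:
  "map_poly of_int (pcompose p q) =
    (pcompose (map_poly of_int p) (map_poly of_int q) :: 'a::comm_ring_1 poly)"
proof (induction p)
  case (pCons a p)
  then show ?case
    by (simp add: pcompose_pCons map_poly_of_int_add map_poly_of_int_mult map_poly_pCons)
qed simp

lemma pcompose_map_rev_dickson:
  "pcompose (map_poly of_int (rev_dickson n)) [:0, 1, -1:] =
    ([:0, 1:] ^ n + [:1, -1:] ^ n :: 'a::comm_ring_1 poly)"
  using arg_cong[OF pcompose_rev_dickson[of n], of "map_poly (of_int :: int \<Rightarrow> 'a)"]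
  by (simp add: map_poly_of_int_pcompose map_poly_of_int_add map_poly_of_int_power map_poly_pCons)

subsection \<open>Power sums over a finite field\<close>

lemma card_field_ge_2: "CARD('a::{field,finite}) \<ge> 2"
proof -
  have "card {0, 1 :: 'a} \<le> CARD('a)" by (rule card_mono) auto
  then show ?thesis by simp
qed

text \<open>Multiplication by a nonzero \<open>x\<close> permutes the nonzero elements, so their
  product is unchanged and yet multiplied by \<open>x^(q-1)\<close>.\<close>

lemma finite_field_power_card:
  fixes x :: "'a::{field,finite}"
  shows "x ^ CARD('a) = x"
proof (cases "x = 0")
  case False
  let ?U = "UNIV - {0 :: 'a}"
  have "(\<Prod>y\<in>?U. x * y) = \<Prod>?U"
    by (rule prod.reindex_bij_witness[of _ "\<lambda>y. y / x" "(*) x"]) (use False in auto)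
  then have "x ^ card ?U * \<Prod>?U = 1 * \<Prod>?U" by (simp only: prod.distrib prod_constant mult_1)
  moreover have "\<Prod>?U \<noteq> 0" by (simp add: prod_zero_iff)
  ultimately have "x ^ card ?U = 1" by (simp only: mult_cancel_right) blast
  moreover have "CARD('a) = Suc (card ?U)"
    using card_field_ge_2[where 'a = 'a] by (simp add: card_Diff_singleton)
  ultimately show ?thesis by (simp only: power_Suc mult_1_right)
qed (use card_field_ge_2[where 'a = 'a] in simp)

text \<open>Translation by 1 permutes the field and adds 1 to each of the \<open>q\<close>
  summands.\<close>

lemma of_nat_card_field: "of_nat CARD('a) = (0 :: 'a::{field,finite})"
proof -
  have "(\<Sum>x\<in>UNIV. x + 1) = (\<Sum>x\<in>UNIV. x :: 'a)"
    by (rule sum.reindex_bij_witness[of _ "\<lambda>x. x - 1" "\<lambda>x. x + 1"]) auto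
  then show ?thesis by (simp add: sum.distrib)
qed

text \<open>The exponent is kept positive so that \<open>x = 0\<close> is covered in spite of
  \<open>0 ^ 0 = 1\<close>.\<close>

lemma power_eq_of_power_card_minus_1:
  fixes x :: "'a::{field,finite}"
  shows "x ^ (Suc a + k * (CARD('a) - 1)) = x ^ Suc a"
proof (induction k)
  case (Suc k)
  have "x ^ (Suc a + Suc k * (CARD('a) - 1)) = x ^ CARD('a) * x ^ (a + k * (CARD('a) - 1))"
    using card_field_ge_2[where 'a = 'a] unfolding power_add[symmetric]
    by (intro arg_cong[of _ _ "(^) x"]) simp
  also have "\<dots> = x ^ (Suc a + k * (CARD('a) - 1))" by (simp add: finite_field_power_card)
  finally show ?case by (simp only: Suc)
qed simp

text \<open>If \<open>q - 1\<close> divides \<open>i > 0\<close>, each nonzero \<open>x\<close>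
  contributes 1. Otherwise the substitution of \<open>c x\<close> for \<open>x\<close> multiplies
  the sum by a factor different from 1. For \<open>i = 0\<close> the sum is \<open>q\<close>, which
  is zero in the field.\<close>

lemma sum_power_finite_field:
  "(\<Sum>x\<in>UNIV. x ^ i) = (if i > 0 \<and> (CARD('a) - 1) dvd i then -1 else (0 :: 'a::{field,finite}))"
proof (cases "i = 0")
  case True
  then show ?thesis by (simp add: of_nat_card_field)
next
  case i: False
  let ?q = "CARD('a)"
  have q: "?q \<ge> 2" by (rule card_field_ge_2)
  show ?thesis
  proof (cases "(?q - 1) dvd i")
    case True
    then obtain k where k: "i = k * (?q - 1)" by (metis dvd_def mult.commute)
    with i have "k > 0" by auto
    have "x ^ i = (if x = 0 then 0 else 1)" for x :: 'a
    proof (cases "x = 0")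
      case False
      have "x ^ Suc (0 + k * (?q - 1)) = x"
        using power_eq_of_power_card_minus_1[of x 0 k] by simp
      with False show ?thesis by (simp add: k)
    qed (use i in simp)
    then have "(\<Sum>x\<in>UNIV. x ^ i) = (\<Sum>x\<in>UNIV. 1 - (if x = (0 :: 'a) then 1 else 0 :: 'a))"
      by (intro sum.cong refl) auto
    also have "\<dots> = - 1" by (simp add: sum_subtractf of_nat_card_field sum.delta)
    finally show ?thesis using True i by simp
  next
    case False
    define r where "r = i mod (?q - 1)"
    have r: "0 < r" "r < ?q - 1" using False q by (auto simp: r_def intro!: Nat.gr0I)
    have xr: "x ^ i = x ^ r" for x :: 'a
    proof -
      have 1: "Suc (r - 1) = r" using r by simp
      have 2: "r + i div (?q - 1) * (?q - 1) = i" unfolding r_def by (rule mod_div_mult_eq)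
      show ?thesis
        using power_eq_of_power_card_minus_1[of x "r - 1" "i div (?q - 1)"] by (simp only: 1 2)
    qed
    \<comment> \<open>Otherwise \<open>X^(r+1)\<close> and \<open>X\<close> would agree at all
      \<open>q\<close> elements although both degrees are below \<open>q\<close>.\<close>
    have "\<exists>c :: 'a. c \<noteq> 0 \<and> c ^ r \<noteq> 1"
    proof (rule ccontr)
      assume "\<not> ?thesis"
      then have *: "c ^ Suc r = c" for c :: 'a by (cases "c = 0") auto
      have "monom 1 (Suc r) = [:0, 1 :: 'a:]"
      proof (rule poly_eqI_degree[of UNIV])
        show "poly (monom 1 (Suc r)) c = poly [:0, 1:] c" for c :: 'a
          unfolding poly_monom * by simp
      qed (use r in \<open>simp_all add: degree_monom_eq\<close>)
      then have "coeff (monom 1 (Suc r)) (Suc r) = coeff [:0, 1 :: 'a:] (Suc r)" by simp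
      then show False using r by (simp add: coeff_eq_0)
    qed
    then obtain c :: 'a where c: "c \<noteq> 0" "c ^ r \<noteq> 1" by blast
    have "(\<Sum>x\<in>UNIV. (c * x) ^ r) = (\<Sum>x\<in>UNIV. x ^ r)"
      by (rule sum.reindex_bij_witness[of _ "\<lambda>y. y / c" "(*) c"]) (use c in auto)
    then have "c ^ r * (\<Sum>x\<in>UNIV. x ^ r) = (\<Sum>x\<in>UNIV. x ^ r)"
      by (simp add: power_mult_distrib sum_distrib_left)
    then have "(\<Sum>x\<in>UNIV. x ^ r :: 'a) = 0" using c by auto
    then show ?thesis using False by (simp add: xr)
  qed
qed

lemma sum_poly_finite_field:
  fixes p :: "'a::{field,finite} poly"
  assumes "degree p < Suc N * (CARD('a) - 1)"
  shows "(\<Sum>x\<in>UNIV. poly p x) = - (\<Sum>k=1..N. coeff p (k * (CARD('a) - 1)))"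
proof -
  let ?d = "CARD('a) - 1"
  have d: "?d > 0" using card_field_ge_2[where 'a = 'a] by simp
  have "(\<Sum>x\<in>UNIV. poly p x) = (\<Sum>i\<le>degree p. coeff p i * (\<Sum>x\<in>UNIV. x ^ i))"
    unfolding poly_altdef by (subst sum.swap) (simp add: sum_distrib_left)
  also have "\<dots> = (\<Sum>i<Suc N * ?d. coeff p i * (\<Sum>x\<in>UNIV. x ^ i))"
    using assms by (intro sum.mono_neutral_left) (auto simp: coeff_eq_0 simp del: mult_Suc)
  also have "\<dots> = (\<Sum>i\<in>(\<lambda>k. k * ?d) ` {1..N}. - coeff p i)"
  proof (rule sum.mono_neutral_cong_right)
    show "(\<lambda>k. k * ?d) ` {1..N} \<subseteq> {..<Suc N * ?d}"
      using d by (auto simp del: mult_Suc intro!: mult_strict_right_mono)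
    show "\<forall>i\<in>{..<Suc N * ?d} - (\<lambda>k. k * ?d) ` {1..N}. coeff p i * (\<Sum>x\<in>UNIV. x ^ i) = 0"
    proof
      fix i assume i: "i \<in> {..<Suc N * ?d} - (\<lambda>k. k * ?d) ` {1..N}"
      have "\<not> (i > 0 \<and> ?d dvd i)"
      proof
        assume "i > 0 \<and> ?d dvd i"
        then obtain k where k: "i = k * ?d" "k > 0" by (auto simp: dvd_def mult.commute)
        with i d have "k < Suc N" by (metis Diff_iff lessThan_iff mult_less_cancel2)
        with k i show False by auto
      qed
      then show "coeff p i * (\<Sum>x\<in>UNIV. x ^ i) = 0"
        by (simp only: sum_power_finite_field if_False mult_zero_right)
    qed
  qed (use d in \<open>auto simp: sum_power_finite_field not_less\<close>)
  also have "\<dots> = - (\<Sum>k=1..N. coeff p (k * ?d))"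
    using d by (subst sum.reindex) (auto simp: inj_on_def sum_negf)
  finally show ?thesis .
qed

subsection \<open>Sums over the roots of the polynomial h\<close>

text \<open>The Frobenius identity, obtained without naming the characteristic: both sides have
  degree at most \<open>q\<close>, the same coefficient at \<open>X^q\<close>, and the same value at
  all \<open>q\<close> elements.\<close>

lemma one_plus_X_power_card:
  "[:1, 1:] ^ CARD('a) = (1 + [:0, 1:] ^ CARD('a) :: 'a::{field,finite} poly)"
proof (rule poly_eqI_degree_lead_coeff[of _ "CARD('a)" _ UNIV])
  show "coeff ([:1, 1:] ^ CARD('a)) CARD('a) = coeff (1 + [:0, 1:] ^ CARD('a) :: 'a poly) CARD('a)"
    using coeff_X_power_mult[of "CARD('a)" "1 :: 'a poly" "CARD('a)"]
      card_field_ge_2[where 'a = 'a]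
    by (simp add: coeff_linear_power)
  show "degree ([:1, 1:] ^ CARD('a) :: 'a poly) \<le> CARD('a)"
    using degree_power_le[of "[:1, 1 :: 'a:]" "CARD('a)"] by simp
  show "degree (1 + [:0, 1:] ^ CARD('a) :: 'a poly) \<le> CARD('a)"
    using degree_power_le[of "[:0, 1 :: 'a:]" "CARD('a)"] by (simp add: degree_add_le)
qed (auto simp: poly_power finite_field_power_card)

lemma pcompose_power: "pcompose (p ^ n) r = pcompose p r ^ n" for r :: "'a::comm_semiring_1 poly"
  by (induction n) (simp_all add: pcompose_mult pcompose_1)

text \<open>This is \<open>h = X^q + X - 1\<close>. A root \<open>x\<close> in an algebraic closure
  satisfies \<open>x^q = 1 - x\<close>, so \<open>x (1 - x)\<close> is the norm of \<open>x\<close>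
  from the quadratic extension.\<close>

definition artin_poly :: "'a::{field,finite} poly" where
  "artin_poly = [:0, 1:] ^ CARD('a) - [:1, -1:]"

lemma degree_artin_poly: "degree (artin_poly :: 'a::{field,finite} poly) = CARD('a)"
  and artin_poly_nonzero: "(artin_poly :: 'a::{field,finite} poly) \<noteq> 0"
proof -
  let ?X = "[:0, 1:] ^ CARD('a) :: 'a poly"
  have "degree ?X = CARD('a)" by (simp add: degree_power_eq)
  moreover have "degree [:1, -1 :: 'a:] < CARD('a)" using card_field_ge_2[where 'a = 'a] by simp
  ultimately show d: "degree (artin_poly :: 'a poly) = CARD('a)"
    unfolding artin_poly_def by (metis degree_add_eq_left degree_minus diff_conv_add_uminus)
  show "(artin_poly :: 'a poly) \<noteq> 0" using d card_field_ge_2[where 'a = 'a] by fastforce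
qed

text \<open>This is the sum of \<open>p\<close> over the roots of \<open>h\<close> in an algebraic closure: by Newton's
  identities, the power sums of exponent below \<open>q - 1\<close> vanish and the next one is 1.\<close>
definition artin_trace :: "'a::{field,finite} poly \<Rightarrow> 'a" where
  "artin_trace p = coeff (p mod artin_poly) (CARD('a) - 1)"

lemma artin_trace_add: "artin_trace (p + q) = artin_trace p + artin_trace q"
  by (simp add: artin_trace_def poly_mod_add_left)

lemma artin_trace_smult: "artin_trace (smult c p) = c * artin_trace p"
  by (simp add: artin_trace_def mod_smult_left)

lemma artin_trace_cong: "[p = q] (mod artin_poly) \<Longrightarrow> artin_trace p = artin_trace q"
  by (simp add: artin_trace_def cong_def)

lemma degree_mod_artin_poly: "degree (p mod artin_poly :: 'a::{field,finite} poly) < CARD('a)"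
  using degree_mod_less'[of "artin_poly :: 'a poly" p]
    card_field_ge_2[where 'a = 'a]
  by (cases "p mod artin_poly = 0") (simp_all add: degree_artin_poly artin_poly_nonzero)

text \<open>The terms come from the expansion of \<open>1/h\<close> at infinity, \<open>1/h = \<Sum> (1 - X)^t / X^(q (t + 1))\<close>; on
  multiples of \<open>h\<close> the sum telescopes.\<close>
lemma artin_trace_eq_sum:
  fixes p :: "'a::{field,finite} poly"
  assumes "degree p + 1 < N * (CARD('a) - 1)"
  shows "artin_trace p = (\<Sum>t<N. coeff (p * [:1, -1:] ^ t) (CARD('a) * Suc t - 1))"
proof -
  define q where "q = CARD('a)"
  define R where "R p = (\<Sum>t<N. coeff (p * [:1, -1:] ^ t) (q * Suc t - 1))" for p :: "'a poly"
  have q: "q \<ge> 2" unfolding q_def by (rule card_field_ge_2)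
  have N: "N > 0" using assms by (cases N) auto
  define g r where "g = p div artin_poly" and "r = p mod artin_poly"
  have p: "p = g * artin_poly + r" by (simp add: g_def r_def)
  \<comment> \<open>For \<open>t > 0\<close> the degree of \<open>r (1 - X)^t\<close> is at most
    \<open>q - 1 + t\<close>, which is below \<open>q (t + 1) - 1\<close>; only \<open>t = 0\<close>
    remains.\<close>
  have "R r = coeff r (q - 1)"
  proof -
    have "coeff (r * [:1, -1:] ^ t) (q * Suc t - 1) = 0" if "t \<noteq> 0" for t
    proof (rule coeff_eq_0)
      have "degree (r * [:1, -1:] ^ t) \<le> degree r + degree ([:1, -1 :: 'a:] ^ t)"
        by (rule degree_mult_le)
      also have "\<dots> \<le> (q - 1) + t"
        using degree_mod_artin_poly[of p] degree_power_le[of "[:1, -1 :: 'a:]" t]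
        by (auto simp: r_def q_def intro!: add_mono)
      also have "\<dots> < q * Suc t - 1"
      proof -
        have "t * 2 \<le> t * q" using q by (rule mult_le_mono2)
        then have "t < q * t" using that by (simp add: mult.commute)
        then show ?thesis using q unfolding mult_Suc_right by linarith
      qed
      finally show "degree (r * [:1, -1:] ^ t) < q * Suc t - 1" .
    qed
    then have "R r = (\<Sum>t<N. if t = 0 then coeff r (q - 1) else 0)"
      unfolding R_def by (intro sum.cong) auto
    then show ?thesis using N by (simp add: sum.delta)
  qed
  moreover have "R (g * artin_poly) = 0"
  proof -
    \<comment> \<open>The last factor forces \<open>a 0 = 0\<close>: the true index there is -1, but
      natural subtraction would read off the constant coefficient.\<close>
    define a where "a t = coeff (g * [:1, -1:] ^ t) (q * t - 1) * (if t = 0 then 0 else 1)" for t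
    have "coeff (g * artin_poly * [:1, -1:] ^ t) (q * Suc t - 1) = a t - a (Suc t)" for t
    proof -
      have "g * artin_poly * [:1, -1:] ^ t =
          [:0, 1:] ^ q * (g * [:1, -1:] ^ t) - g * [:1, -1:] ^ Suc t"
        unfolding artin_poly_def q_def[symmetric] by (simp only: power_Suc) (simp only: algebra_simps)
      then have "coeff (g * artin_poly * [:1, -1:] ^ t) (q * Suc t - 1) =
          (if q \<le> q * Suc t - 1 then coeff (g * [:1, -1:] ^ t) (q * Suc t - 1 - q) else 0) -
          coeff (g * [:1, -1:] ^ Suc t) (q * Suc t - 1)"
        by (simp only: coeff_diff coeff_X_power_mult)
      moreover have "q \<le> q * Suc t - 1 \<longleftrightarrow> t \<noteq> 0" "q * Suc t - 1 - q = q * t - 1"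
        using q by (cases t; simp)+
      ultimately show ?thesis by (simp add: a_def del: power_Suc)
    qed
    then have "R (g * artin_poly) = (\<Sum>t<N. a t - a (Suc t))" by (simp add: R_def)
    also have "\<dots> = a 0 - a N" by (rule sum_lessThan_telescope')
    also have "a 0 = 0" by (simp add: a_def)
    also have "a N = 0"
    proof -
      \<comment> \<open>The bound on \<open>N\<close> is chosen to make this boundary term of the
        telescoping sum vanish.\<close>
      have "coeff (g * [:1, -1:] ^ N) (q * N - 1) = 0"
      proof (rule coeff_eq_0)
        have "degree g \<le> degree p"
        proof (cases "g = 0")
          case False
          then have "degree (g * artin_poly) = degree g + CARD('a)"
            by (simp add: degree_mult_eq artin_poly_nonzero degree_artin_poly)
          moreover from this have "degree p = degree (g * artin_poly)"
            using degree_mod_artin_poly[of p]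
            by (subst p) (intro degree_add_eq_left, simp add: r_def)
          ultimately show ?thesis by simp
        qed simp
        moreover have "degree (g * [:1, -1:] ^ N) \<le> degree g + N"
          using degree_mult_le[of g "[:1, -1 :: 'a:] ^ N"] degree_power_le[of "[:1, -1 :: 'a:]" N]
          by simp
        moreover have "q * N = N * (q - 1) + N" using q by (simp add: algebra_simps)
        ultimately show "degree (g * [:1, -1:] ^ N) < q * N - 1"
          using assms by (simp add: q_def)
      qed
      then show ?thesis by (simp add: a_def)
    qed
    finally show ?thesis by simp
  qed
  moreover have "R p = R (g * artin_poly) + R r"
    by (subst p) (simp add: R_def algebra_simps sum.distrib)
  ultimately show ?thesis by (simp add: artin_trace_def r_def R_def q_def)
qed

lemma cong_X_power_card:
  "[[:0, 1:] ^ CARD('a) = [:1, -1:]] (mod (artin_poly :: 'a::{field,finite} poly))"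
  by (simp add: cong_iff_dvd_diff artin_poly_def)

section \<open>Odd \<open>q\<close>: the symmetry exchanging \<open>X\<close> and
  \<open>1 - X\<close>\<close>

lemma two_nonzero:
  assumes "odd CARD('a::{field,finite})"
  shows "(2 :: 'a) \<noteq> 0"
proof
  assume two: "(2 :: 'a) = 0"
  obtain k where "CARD('a) = 2 * k + 1" using assms by (rule oddE)
  then have "of_nat CARD('a) = (2 * of_nat k + 1 :: 'a)" by simp
  then show False using two by (simp add: of_nat_card_field)
qed

lemma one_minus_X_power_card:
  assumes "odd CARD('a)"
  shows "[:1, -1:] ^ CARD('a) = (1 - [:0, 1:] ^ CARD('a) :: 'a::{field,finite} poly)"
proof -
  have "pcompose ([:1, 1:] ^ CARD('a)) [:0, -1 :: 'a:] = pcompose (1 + [:0, 1:] ^ CARD('a)) [:0, -1:]"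
    by (simp only: one_plus_X_power_card)
  moreover have "[:0, -1 :: 'a:] ^ CARD('a) = - ([:0, 1:] ^ CARD('a))"
    using power_minus_odd[OF assms, of "[:0, 1 :: 'a:]"] by simp
  ultimately show ?thesis
    by (simp add: pcompose_add pcompose_power pcompose_pCons pcompose_1)
qed

text \<open>With \<open>cong_X_power_card\<close>, this says that the \<open>q\<close>-th power
  exchanges \<open>X\<close> and \<open>1 - X\<close> modulo \<open>h\<close>.\<close>

lemma cong_one_minus_X_power_card:
  assumes "odd CARD('a)"
  shows "[[:1, -1:] ^ CARD('a) = [:0, 1:]] (mod (artin_poly :: 'a::{field,finite} poly))"
proof -
  have "[:1, -1:] ^ CARD('a) - [:0, 1:] = - (artin_poly :: 'a poly)"
    by (simp add: one_minus_X_power_card[OF assms] artin_poly_def one_pCons)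
  then show ?thesis by (simp add: cong_iff_dvd_diff)
qed

text \<open>The substitution of \<open>1 - X\<close> for \<open>X\<close> sends \<open>h\<close> to
  \<open>-h\<close> and thus permutes the roots. On a remainder it keeps the degree, and the
  coefficient at \<open>X^(q-1)\<close> is unchanged because \<open>q - 1\<close> is even.\<close>

lemma artin_trace_reflect:
  assumes "odd CARD('a)"
  shows "artin_trace (pcompose p [:1, -1:]) = artin_trace (p :: 'a::{field,finite} poly)"
proof -
  let ?\<tau> = "[:1, -1 :: 'a:]"
  define r where "r = p mod artin_poly"
  have refl: "pcompose artin_poly ?\<tau> = (- artin_poly :: 'a poly)"
    by (simp add: artin_poly_def pcompose_diff pcompose_power pcompose_pCons
        one_minus_X_power_card[OF assms] one_pCons)
  have "pcompose p ?\<tau> = pcompose ((p div artin_poly) * artin_poly + r) ?\<tau>" by (simp add: r_def)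
  also have "\<dots> = - (pcompose (p div artin_poly) ?\<tau>) * artin_poly + pcompose r ?\<tau>"
    by (simp add: pcompose_add pcompose_mult refl)
  finally have "pcompose p ?\<tau> mod artin_poly = pcompose r ?\<tau> mod artin_poly"
    by (simp only: mod_mult_self3)
  also have r: "degree r < CARD('a)" by (simp add: r_def degree_mod_artin_poly)
  then have "pcompose r ?\<tau> mod artin_poly = pcompose r ?\<tau>"
    by (intro mod_poly_less) (simp add: degree_artin_poly degree_pcompose)
  finally have 1: "artin_trace (pcompose p ?\<tau>) = coeff (pcompose r ?\<tau>) (CARD('a) - 1)"
    by (simp add: artin_trace_def)
  have "coeff (pcompose r ?\<tau>) (CARD('a) - 1) = coeff r (CARD('a) - 1)"
  proof (cases "degree r = CARD('a) - 1")
    case True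
    have "lead_coeff (pcompose r ?\<tau>) = lead_coeff r * (- 1) ^ degree r"
      by (subst lead_coeff_comp) auto
    moreover have "even (CARD('a) - 1)" using assms by simp
    ultimately show ?thesis using True by (simp add: degree_pcompose)
  next
    case False
    with r have "degree r < CARD('a) - 1" by simp
    then show ?thesis by (simp add: coeff_eq_0 degree_pcompose)
  qed
  then show ?thesis unfolding 1 by (simp add: artin_trace_def r_def)
qed

lemma poly_X_minus_X_squared: "[:0, 1, -1:] = [:0, 1:] * [:1, -1 :: 'a::comm_ring_1:]"
  by simp

lemma coeff_pcompose_X_minus_X_squared:
  fixes p :: "'a::idom poly"
  assumes "degree p \<le> n"
  shows "coeff (pcompose p [:0, 1, -1:]) (2 * n) = (-1) ^ n * coeff p n"
proof (cases "degree p = n")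
  case True
  have "degree (pcompose p [:0, 1, -1:]) = 2 * n" by (simp add: degree_pcompose True)
  moreover have "lead_coeff (pcompose p [:0, 1, -1:]) = lead_coeff p * (- 1) ^ degree p"
    by (subst lead_coeff_comp) auto
  ultimately show ?thesis using True by simp
next
  case False
  with assms have "degree p < n" by simp
  then show ?thesis by (simp add: coeff_eq_0 degree_pcompose)
qed

text \<open>Both sides only depend on \<open>F\<close> modulo \<open>X^q - X\<close>, because \<open>X^q - X\<close> composed with \<open>X (1 - X)\<close> is
  \<open>- (X^q - X) h\<close>. For \<open>F\<close> of degree below \<open>q\<close>, only the coefficient of \<open>X^(2q-2)\<close> survives.\<close>
lemma two_times_sum_poly:
  fixes F :: "'a::{field,finite} poly"
  assumes "odd CARD('a)"
  defines "f \<equiv> pcompose F [:0, 1, -1:]"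
  shows "2 * (\<Sum>a\<in>UNIV. poly F a) = (\<Sum>x\<in>UNIV. poly f x) + artin_trace f"
proof -
  let ?q = "CARD('a)" and ?\<sigma> = "[:0, 1, -1 :: 'a:]"
  define W where "W = [:0, 1:] ^ ?q - [:0, 1 :: 'a:]"
  have q: "?q \<ge> 2" "odd ?q" using card_field_ge_2 assms by auto
  have dW: "degree W = ?q"
  proof -
    have "degree ([:0, 1:] ^ ?q :: 'a poly) = ?q" by (simp add: degree_power_eq)
    moreover have "degree [:0, 1 :: 'a:] < ?q" using q by simp
    ultimately show ?thesis unfolding W_def by (metis degree_add_eq_left degree_minus diff_conv_add_uminus)
  qed
  have pW: "poly W x = 0" for x by (simp add: W_def poly_power finite_field_power_card)
  define G0 F0 where "G0 = F div W" and "F0 = F mod W"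
  have F: "F = G0 * W + F0" by (simp add: G0_def F0_def)
  have dF0: "degree F0 \<le> ?q - 1"
    using degree_mod_less[of W F] dW q by (cases "W = 0"; cases "F0 = 0") (auto simp: F0_def)
  define f0 where "f0 = pcompose F0 ?\<sigma>"
  have "pcompose W ?\<sigma> = - (W * artin_poly)"
  proof -
    have "pcompose W ?\<sigma> = ?\<sigma> ^ ?q - ?\<sigma>"
      by (simp add: W_def pcompose_diff pcompose_power pcompose_pCons)
    also have "?\<sigma> ^ ?q = [:0, 1:] ^ ?q * (1 - [:0, 1:] ^ ?q)"
      unfolding poly_X_minus_X_squared power_mult_distrib one_minus_X_power_card[OF q(2)] ..
    also have "\<dots> - ?\<sigma> = - (W * artin_poly)"
    proof -
      define x y where "x = [:0, 1 :: 'a:]" and "y = x ^ ?q"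
      have e: "[:1, -1:] = 1 - x" by (simp add: x_def one_pCons)
      show ?thesis
        unfolding W_def artin_poly_def poly_X_minus_X_squared
        unfolding e x_def[symmetric] y_def[symmetric]
        by (simp add: algebra_simps)
    qed
    finally show ?thesis .
  qed
  then have f: "f = - (pcompose G0 ?\<sigma> * W) * artin_poly + f0"
    unfolding f_def f0_def by (subst F) (simp add: pcompose_add pcompose_mult)
  have "artin_trace f = artin_trace f0"
    unfolding artin_trace_def by (subst f) (simp only: mod_mult_self3)
  moreover have "(\<Sum>x\<in>UNIV. poly f x) = (\<Sum>x\<in>UNIV. poly f0 x)"
    by (subst f) (simp add: pW)
  moreover have "(\<Sum>x\<in>UNIV. poly F x) = (\<Sum>x\<in>UNIV. poly F0 x)"
    by (subst F) (simp add: pW)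
  moreover have "2 * (\<Sum>a\<in>UNIV. poly F0 a) = (\<Sum>x\<in>UNIV. poly f0 x) + artin_trace f0"
  proof -
    have df0: "degree f0 \<le> 2 * (?q - 1)" using dF0 by (simp add: f0_def degree_pcompose)
    have lead: "coeff f0 (2 * (?q - 1)) = coeff F0 (?q - 1)"
      using coeff_pcompose_X_minus_X_squared[OF dF0] q by (simp add: f0_def)
    have "(\<Sum>a\<in>UNIV. poly F0 a) = - coeff F0 (?q - 1)"
      using sum_poly_finite_field[of F0 1] dF0 q by simp
    moreover have "(\<Sum>a\<in>UNIV. poly f0 a) = - coeff f0 (?q - 1) - coeff f0 (2 * (?q - 1))"
      using sum_poly_finite_field[of f0 2] df0 q by (simp add: numeral_2_eq_2)
    \<comment> \<open>The expansion term at \<open>t = 0\<close> gives the first coefficient,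
      \<open>t = 1\<close> the second with the sign from \<open>1 - X\<close>, and
      \<open>t = 2\<close> lies beyond the degree. Added to the sum over the field, the coefficient
      at \<open>q - 1\<close> cancels and the one at \<open>2 (q - 1)\<close> is doubled.\<close>
    moreover have "artin_trace f0 = coeff f0 (?q - 1) - coeff f0 (2 * (?q - 1))"
    proof -
      have q3: "?q \<ge> 3" using q by (cases "?q = 2") auto
      have "degree (f0 * [:1, -1:] ^ 2) \<le> 2 * (?q - 1) + 2"
        using degree_mult_le[of f0 "[:1, -1:] ^ 2"] degree_power_le[of "[:1, -1 :: 'a:]" 2] df0
        by simp
      then have "coeff (f0 * [:1, -1:] ^ 2) (?q * 3 - 1) = 0"
        using q3 by (intro coeff_eq_0) linarith
      moreover have "coeff (f0 * [:1, -1:]) (?q * 2 - 1) = - coeff f0 (2 * (?q - 1))"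
      proof -
        have "coeff f0 (?q * 2 - 1) = 0" using df0 q3 by (intro coeff_eq_0) linarith
        moreover have "?q * 2 - 1 = Suc (2 * (?q - 1))" using q3 by simp
        ultimately show ?thesis by simp
      qed
      ultimately show ?thesis
        using artin_trace_eq_sum[of f0 3] df0 q3 by (simp add: eval_nat_numeral)
    qed
    ultimately show ?thesis using lead by simp
  qed
  ultimately show ?thesis by simp
qed

subsection \<open>The contribution of the exponent 3n\<close>

lemma coeff_one_plus_X_power:
  "coeff ([:1, 1:] ^ b :: 'a::comm_semiring_1 poly) k = of_nat (b choose k)"
proof (cases "k \<le> b")
  case False
  have "degree ([:1, 1:] ^ b :: 'a poly) \<le> degree ([:1, 1:] :: 'a poly) * b"
    by (rule degree_power_le)
  also have "\<dots> \<le> b" by simp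
  finally show ?thesis using False by (simp add: coeff_eq_0 binomial_eq_0)
qed (simp add: coeff_linear_poly_power)

text \<open>One step of Lucas' congruence: compare coefficients in
  \<open>(1 + X)^q (1 + X)^r = (1 + X^q) (1 + X)^r\<close>.\<close>

lemma binomial_card_add:
  "(of_nat ((CARD('a) + r) choose k) :: 'a::{field,finite}) =
    of_nat (r choose k) + (if CARD('a) \<le> k then of_nat (r choose (k - CARD('a))) else 0)"
proof -
  have "of_nat ((CARD('a) + r) choose k) = coeff ([:1, 1 :: 'a:] ^ CARD('a) * [:1, 1:] ^ r) k"
    by (simp only: coeff_one_plus_X_power power_add[symmetric])
  also have "\<dots> = coeff ([:1, 1:] ^ r + [:0, 1:] ^ CARD('a) * [:1, 1:] ^ r) k"
    by (simp only: one_plus_X_power_card distrib_right mult_1)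
  finally show ?thesis by (simp add: coeff_X_power_mult coeff_one_plus_X_power)
qed

text \<open>The coefficients \<open>q choose j\<close> with \<open>0 < j < q\<close> vanish in the
  field, so by Pascal's rule the row \<open>q - 1\<close> alternates between 1 and -1.\<close>

lemma binomial_card_minus_1:
  "k < CARD('a) \<Longrightarrow> (-1) ^ k * of_nat ((CARD('a) - 1) choose k) = (1 :: 'a::{field,finite})"
proof (induction k)
  case (Suc k)
  have "CARD('a) choose Suc k = ((CARD('a) - 1) choose k) + ((CARD('a) - 1) choose Suc k)"
    using choose_reduce_nat[of "CARD('a)" "Suc k"] Suc.prems by simp
  moreover have "of_nat (CARD('a) choose Suc k) = (0 :: 'a)"
    using binomial_card_add[of 0 "Suc k", where 'a = 'a] Suc.prems by simp
  ultimately have "of_nat ((CARD('a) - 1) choose Suc k) = - (of_nat ((CARD('a) - 1) choose k) :: 'a)"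
    by (metis add_eq_0_iff of_nat_add)
  then show ?case using Suc by simp
qed simp

text \<open>Upper negation, with \<open>q - 1 - d\<close> standing for \<open>-1 - d\<close>. Both
  sides obey the same Pascal recurrence in \<open>d\<close> and \<open>k\<close>; factorials may
  vanish in the field, so induction replaces the quotient formula.\<close>

lemma binomial_reflect:
  assumes "k < CARD('a)" "d < CARD('a)"
  shows "(-1) ^ k * of_nat ((CARD('a) - 1 - d) choose k) =
    (of_nat ((d + k) choose k) :: 'a::{field,finite})"
  using assms
proof (induction d arbitrary: k)
  case 0
  then show ?case by (simp add: binomial_card_minus_1 del: One_nat_def)
next
  case (Suc d)
  note outer = Suc
  from outer(2) show ?case
  proof (induction k)
    case (Suc k)
    let ?c = "CARD('a) - 1 - Suc d"
    have "CARD('a) - 1 - d = Suc ?c" using outer(3) by simp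
    then have "(-1) ^ Suc k * of_nat (Suc ?c choose Suc k) = (of_nat ((d + Suc k) choose Suc k) :: 'a)"
      using outer(1)[of "Suc k"] Suc.prems outer(3) by simp
    moreover have "(-1) ^ k * of_nat (?c choose k) = (of_nat ((Suc d + k) choose k) :: 'a)"
      using Suc by simp
    moreover have "of_nat ((Suc d + Suc k) choose Suc k) =
        (of_nat ((d + Suc k) choose Suc k) + of_nat ((Suc d + k) choose k) :: 'a)"
      by (simp add: ac_simps flip: of_nat_add)
    moreover have "(-1) ^ Suc k * of_nat (?c choose Suc k) =
        ((-1) ^ Suc k * of_nat (Suc ?c choose Suc k) + (-1) ^ k * of_nat (?c choose k) :: 'a)"
      by (simp add: algebra_simps)
    ultimately show ?case by (simp only:)
  qed simp
qed

section \<open>Units and powers modulo \<open>h\<close>\<close>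

lemma cong_cancel_unit:
  fixes x :: "'a::unique_euclidean_ring"
  assumes "[x * z = 1] (mod h)" "[x * a = x * b] (mod h)"
  shows "[a = b] (mod h)"
proof -
  have 1: "[x * z * c = 1 * c] (mod h)" for c using assms(1) by (intro cong_mult cong_refl)
  have "[x * z * a = x * z * b] (mod h)"
    using cong_mult[OF cong_refl[of z] assms(2)] by (simp add: mult_ac)
  then show ?thesis using 1[of a] 1[of b] by (metis cong_sym cong_trans mult_1)
qed

text \<open>The inverse is read off from \<open>h = X (X^(q-1) + 1) - 1\<close>.\<close>

lemma artin_unit_X: "\<exists>z. [[:0, 1:] * z = 1] (mod (artin_poly :: 'a::{field,finite} poly))"
proof -
  have "[:0, 1:] ^ CARD('a) = [:0, 1:] * [:0, 1 :: 'a:] ^ (CARD('a) - 1)"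
    using card_field_ge_2[where 'a = 'a] by (intro power_eq_if[THEN trans]) auto
  then have "[:0, 1:] * ([:0, 1:] ^ (CARD('a) - 1) + 1) - 1 = (artin_poly :: 'a poly)"
    by (simp only: artin_poly_def distrib_left) (simp add: one_pCons)
  then show ?thesis unfolding cong_iff_dvd_diff by (metis dvd_refl)
qed

text \<open>As \<open>1 - X\<close> is congruent to \<open>X^q\<close>, the \<open>q\<close>-th
  power of an inverse of \<open>X\<close> serves.\<close>

lemma artin_unit_one_minus_X:
  "\<exists>z. [[:1, -1:] * z = 1] (mod (artin_poly :: 'a::{field,finite} poly))"
proof -
  obtain z where z: "[[:0, 1:] * z = 1] (mod (artin_poly :: 'a poly))" using artin_unit_X by blast
  have "[[:1, -1:] * z ^ CARD('a) = [:0, 1:] ^ CARD('a) * z ^ CARD('a)] (mod (artin_poly :: 'a poly))"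
    by (intro cong_mult cong_refl cong_sym[OF cong_X_power_card])
  also have "[[:0, 1:] ^ CARD('a) * z ^ CARD('a) = 1 ^ CARD('a)] (mod (artin_poly :: 'a poly))"
    unfolding power_mult_distrib[symmetric] by (intro cong_pow z)
  finally show ?thesis by auto
qed

text \<open>Two applications of the \<open>q\<close>-th power return \<open>X\<close> to itself;
  then the unit \<open>X\<close> is cancelled.\<close>

lemma cong_X_power_card_squared:
  assumes "odd CARD('a)"
  shows "[[:0, 1:] ^ (CARD('a)\<^sup>2 - 1) = 1] (mod (artin_poly :: 'a::{field,finite} poly))"
proof -
  have "[([:0, 1:] ^ CARD('a)) ^ CARD('a) = [:1, -1:] ^ CARD('a)] (mod (artin_poly :: 'a poly))"
    by (intro cong_pow cong_X_power_card)
  also have "[[:1, -1:] ^ CARD('a) = [:0, 1:]] (mod (artin_poly :: 'a poly))"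
    by (rule cong_one_minus_X_power_card[OF assms])
  also have "([:0, 1 :: 'a:] ^ CARD('a)) ^ CARD('a) = [:0, 1:] * [:0, 1:] ^ (CARD('a)\<^sup>2 - 1)"
    unfolding power_mult[symmetric] power2_eq_square using card_field_ge_2[where 'a = 'a]
    by (intro power_eq_if[THEN trans]) auto
  finally have "[[:0, 1:] * [:0, 1:] ^ (CARD('a)\<^sup>2 - 1) = [:0, 1:] * 1] (mod (artin_poly :: 'a poly))"
    by simp
  then show ?thesis using artin_unit_X cong_cancel_unit by blast
qed

lemma cong_X_power_digits:
  assumes "odd CARD('a)" "m mod (CARD('a)\<^sup>2 - 1) = (u + v * CARD('a)) mod (CARD('a)\<^sup>2 - 1)"
  shows "[[:0, 1:] ^ m = [:0, 1:] ^ u * [:1, -1:] ^ v] (mod (artin_poly :: 'a::{field,finite} poly))"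
proof -
  let ?M = "CARD('a)\<^sup>2 - 1" and ?X = "[:0, 1 :: 'a:]"
  have red: "[?X ^ i = ?X ^ (i mod ?M)] (mod artin_poly)" for i
  proof -
    have "[(?X ^ ?M) ^ (i div ?M) * ?X ^ (i mod ?M) = 1 ^ (i div ?M) * ?X ^ (i mod ?M)] (mod artin_poly)"
      by (intro cong_mult cong_pow cong_X_power_card_squared assms(1) cong_refl)
    then show ?thesis
      by (simp only: power_mult[symmetric] power_add[symmetric] mult_div_mod_eq power_one mult_1)
  qed
  have "[?X ^ m = ?X ^ (u + v * CARD('a))] (mod artin_poly)"
    using red[of m] red[of "u + v * CARD('a)"] assms(2) by (metis cong_sym cong_trans)
  also have "?X ^ (u + v * CARD('a)) = ?X ^ u * (?X ^ CARD('a)) ^ v"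
    by (simp only: power_add power_mult[symmetric] mult.commute)
  also have "[\<dots> = ?X ^ u * [:1, -1:] ^ v] (mod artin_poly)"
    by (intro cong_mult cong_refl cong_pow cong_X_power_card)
  finally show ?thesis .
qed

text \<open>The degree is at most \<open>2 (q - 1)\<close>, so three expansion terms suffice. The
  first becomes the stated binomial coefficient by upper negation, the second is nonzero only for
  \<open>u = v = q - 1\<close>, where it is \<open>(-1)^q = -1\<close>, and the third
  vanishes.\<close>

lemma artin_trace_X_one_minus_X:
  assumes "odd CARD('a)" "u < CARD('a)" "v < CARD('a)"
  shows "artin_trace ([:0, 1:] ^ u * [:1, -1:] ^ v :: 'a::{field,finite} poly) =
    of_nat ((2 * (CARD('a) - 1) - u - v) choose (CARD('a) - 1 - u)) -
    (if u = CARD('a) - 1 \<and> v = CARD('a) - 1 then 1 else 0)"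
proof -
  define q where "q = CARD('a)"
  have q: "q \<ge> 3" "odd q" using card_field_ge_2[where 'a = 'a] assms(1)
    by (cases "q = 2"; simp add: q_def)+
  have uv: "u < q" "v < q" using assms by (simp_all add: q_def)
  let ?p = "[:0, 1:] ^ u * [:1, -1 :: 'a:] ^ v"
  have "degree ?p + 1 < 3 * (q - 1)"
    using degree_X_one_minus_X[of u v, where 'a = 'a] uv q by linarith
  then have "artin_trace ?p = (\<Sum>t<3. coeff (?p * [:1, -1:] ^ t) (q * Suc t - 1))"
    unfolding q_def by (rule artin_trace_eq_sum)
  also have "\<dots> = (\<Sum>t<3. coeff ([:0, 1:] ^ u * [:1, -1:] ^ (v + t)) (q * Suc t - 1))"
    by (simp only: power_add mult.assoc)
  also have "\<dots> = (-1) ^ (q - 1 - u) * of_nat (v choose (q - 1 - u))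
      + (-1) ^ (2 * q - 1 - u) * of_nat ((v + 1) choose (2 * q - 1 - u))
      + (-1) ^ (3 * q - 1 - u) * of_nat ((v + 2) choose (3 * q - 1 - u))"
    using uv by (auto simp: coeff_X_one_minus_X eval_nat_numeral)
  also have "(v + 2) choose (3 * q - 1 - u) = 0"
    using uv q by (intro binomial_eq_0) simp
  also have "(-1) ^ (q - 1 - u) * of_nat (v choose (q - 1 - u)) =
      (of_nat ((2 * (q - 1) - u - v) choose (q - 1 - u)) :: 'a)"
  proof -
    have "q - 1 - (q - 1 - v) = v" "(q - 1 - v) + (q - 1 - u) = 2 * (q - 1) - u - v"
      using uv by auto
    then show ?thesis
      using binomial_reflect[of "q - 1 - u" "q - 1 - v", where 'a = 'a] q
      by (simp add: q_def)
  qed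
  also have "(-1) ^ (2 * q - 1 - u) * of_nat ((v + 1) choose (2 * q - 1 - u)) =
      (if u = q - 1 \<and> v = q - 1 then - 1 else 0 :: 'a)"
  proof (cases "u = q - 1 \<and> v = q - 1")
    case True
    then have "2 * q - 1 - u = q" "v + 1 = q" using q by auto
    then show ?thesis using True q by simp
  next
    case False
    then have "v + 1 < 2 * q - 1 - u" using uv by auto
    then show ?thesis using False by (simp add: binomial_eq_0)
  qed
  finally show ?thesis by (simp add: q_def)
qed

lemma sum_power_plus_artin_trace:
  assumes "odd CARD('a)" "u < CARD('a)" "v < CARD('a)" "0 < u + v"
  shows "(\<Sum>x\<in>UNIV. x ^ (u + v)) + artin_trace ([:0, 1:] ^ u * [:1, -1:] ^ v) =
    (if u + v * CARD('a) \<le> CARD('a)\<^sup>2 - 2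
     then - (inverse (2::'a::{field,finite}) ^ (u + v) * of_nat ((u + v) choose (CARD('a) - 1)))
       + of_nat ((2 * (CARD('a) - 1) - u - v) choose (CARD('a) - 1 - u))
     else -1)"
proof -
  define q where "q = CARD('a)"
  have q: "q \<ge> 3" using card_field_ge_2[where 'a = 'a] assms(1)
    by (cases "q = 2"; simp add: q_def)
  have uv: "u < q" "v < q" using assms by (simp_all add: q_def)
  \<comment> \<open>With both digits at most \<open>q - 1\<close>, the value \<open>q^2 - 1\<close>
    is reached only when both are maximal.\<close>
  have range: "u + v * q \<le> q\<^sup>2 - 2 \<longleftrightarrow> \<not> (u = q - 1 \<and> v = q - 1)"
  proof
    assume "u + v * q \<le> q\<^sup>2 - 2"
    moreover have "(q - 1) + (q - 1) * q = q\<^sup>2 - 1" using q by (cases q) (simp_all add: power2_eq_square)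
    moreover have "q\<^sup>2 \<ge> 9" using power_mono[OF q, of 2] by simp
    ultimately show "\<not> (u = q - 1 \<and> v = q - 1)" by auto
  next
    assume *: "\<not> (u = q - 1 \<and> v = q - 1)"
    show "u + v * q \<le> q\<^sup>2 - 2"
    proof (cases "v = q - 1")
      case True
      have "q * q = q + (q - 1) * q" using q by (simp add: algebra_simps)
      then show ?thesis using * True uv q by (simp add: power2_eq_square)
    next
      case False
      then have "v + 2 \<le> q" using uv by simp
      then have "(v + 2) * q \<le> q * q" by (rule mult_le_mono1)
      then show ?thesis using uv by (simp add: power2_eq_square algebra_simps)
    qed
  qed
  have tr: "artin_trace ([:0, 1:] ^ u * [:1, -1:] ^ v :: 'a poly) =
    of_nat ((2 * (q - 1) - u - v) choose (q - 1 - u)) - (if u = q - 1 \<and> v = q - 1 then 1 else 0)"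
    unfolding q_def by (rule artin_trace_X_one_minus_X[OF assms(1-3)])
  have pow: "(\<Sum>x\<in>UNIV. x ^ (u + v)) = (if (q - 1) dvd (u + v) then -1 else (0 :: 'a))"
    using assms(4) by (simp add: sum_power_finite_field q_def)
  show ?thesis
  proof (cases "u = q - 1 \<and> v = q - 1")
    case True
    have "(q - 1) dvd (u + v)" unfolding conjunct1[OF True] conjunct2[OF True] by simp
    then have pow': "(\<Sum>x\<in>UNIV. x ^ (u + v)) = (-1 :: 'a)" by (simp only: pow if_True)
    have nr: "\<not> u + v * q \<le> q\<^sup>2 - 2" using range True by blast
    show ?thesis unfolding q_def[symmetric] tr pow' if_P[OF True] if_not_P[OF nr]
      using True by simp
  next
    case False
    then have lt: "u + v < 2 * (q - 1)" using uv by auto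
    \<comment> \<open>As \<open>0 < u + v < 2 (q - 1)\<close>, the divisibility means
      \<open>u + v = q - 1\<close>, where the power of \<open>1/2\<close> is 1. Below this value the
      binomial coefficient is zero; above it, it vanishes in the field by Lucas' congruence.\<close>
    have "(if (q - 1) dvd (u + v) then -1 else 0) =
        - (inverse (2::'a) ^ (u + v) * of_nat ((u + v) choose (q - 1)))"
    proof (cases "u + v" "q - 1" rule: linorder_cases)
      case less
      then have "\<not> (q - 1) dvd (u + v)" using assms(4) by (auto dest: dvd_imp_le)
      then show ?thesis using less by (simp add: binomial_eq_0)
    next
      case equal
      have "inverse (2::'a) * inverse 2 ^ (q - 1) = inverse 2"
        using finite_field_power_card[of "inverse (2::'a)"] q
        by (simp add: q_def flip: power_Suc)
      then have "inverse (2::'a) ^ (q - 1) = 1"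
        using two_nonzero[OF assms(1)] by simp
      then show ?thesis unfolding equal by simp
    next
      case greater
      have "\<not> (q - 1) dvd (u + v)"
      proof
        assume "(q - 1) dvd (u + v)"
        then obtain k where k: "u + v = (q - 1) * k" by (rule dvdE)
        have "1 < k" "k < 2"
          using greater lt unfolding k by (auto simp: mult.commute)
        then show False by simp
      qed
      moreover have "(of_nat ((u + v) choose (q - 1)) :: 'a) = 0"
      proof -
        have "u + v = q + (u + v - q)" using greater by simp
        then have "(of_nat ((u + v) choose (q - 1)) :: 'a) = of_nat ((q + (u + v - q)) choose (q - 1))"
          by simp
        also have "\<dots> = of_nat ((u + v - q) choose (q - 1))"
          using binomial_card_add[of "u + v - q" "q - 1", where 'a = 'a] q by (simp add: q_def)
        also have "(u + v - q) choose (q - 1) = 0" using lt q by (intro binomial_eq_0) simp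
        finally show ?thesis by simp
      qed
      ultimately show ?thesis by simp
    qed
    then show ?thesis using False range unfolding tr pow q_def[symmetric] by simp
  qed
qed

subsection \<open>The contribution of the mixed term\<close>

lemma power_cong_finite_field:
  fixes x :: "'a::{field,finite}"
  assumes "[a = b] (mod (CARD('a) - 1))" "a > 0" "b > 0"
  shows "x ^ a = x ^ b"
proof -
  have main: "x ^ a = x ^ b" if ab: "a \<le> b" "[a = b] (mod (CARD('a) - 1))" "a > 0" for a b
  proof -
    obtain k where "b - a = (CARD('a) - 1) * k"
      using ab by (metis cong_altdef_nat cong_sym dvdE)
    then have "b = Suc (a - 1) + k * (CARD('a) - 1)" using ab by (simp add: mult.commute)
    then show ?thesis using power_eq_of_power_card_minus_1[of x "a - 1" k] ab by simp
  qed
  show ?thesis using main[of a b] main[of b a] assms by (metis cong_sym nat_le_linear)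
qed

text \<open>Formally the left-hand side is \<open>X^(2r-m) (1 - X)^(r+m)\<close>, since \<open>X^(q-1)\<close> is \<open>(1 - X)/X\<close>; one factor
  \<open>1 - X\<close> is traded for \<open>X^q\<close> to make the exponent of \<open>X\<close> nonnegative.\<close>
lemma cong_shift_power:
  assumes "odd CARD('a)" "n = r + m * (CARD('a) - 1)" "m \<le> CARD('a)" "0 < n"
  shows "[[:0, 1:] ^ (2 * n) * [:1, -1:] ^ n =
    [:0, 1:] ^ (2 * r + CARD('a) - m) * [:1, -1:] ^ (r + m - 1)] (mod (artin_poly :: 'a::{field,finite} poly))"
proof -
  define q where "q = CARD('a)"
  define x y h where "x = [:0, 1 :: 'a:]" and "y = [:1, -1 :: 'a:]" and "h = (artin_poly :: 'a poly)"
  have xq: "[x ^ q = y] (mod h)" unfolding x_def y_def h_def q_def by (rule cong_X_power_card)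
  have yq: "[y ^ q = x] (mod h)" unfolding x_def y_def h_def q_def
    by (rule cong_one_minus_X_power_card[OF assms(1)])
  obtain zx zy where z: "[x * zx = 1] (mod h)" "[y * zy = 1] (mod h)"
    unfolding x_def y_def h_def using artin_unit_X artin_unit_one_minus_X by metis
  have q: "q \<ge> 2" unfolding q_def by (rule card_field_ge_2)
  have m: "m \<le> q" using assms(3) by (simp add: q_def)
  have "m * (q - 1) + m = m * q" using q by (cases q) simp_all
  then have n: "n + m = r + m * q" unfolding assms(2) q_def by linarith
  \<comment> \<open>This keeps the natural subtraction in \<open>r + m - 1\<close> exact.\<close>
  have rm: "r + m \<ge> 1" using assms(2,4) by (cases m) auto
  \<comment> \<open>Both sides are multiplied by this unit: it raises the exponent \<open>n\<close>
    to \<open>n + m = r + m q\<close>, where the rules for \<open>q\<close>-th powers apply.\<close>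
  have z': "[(x ^ (2 * m) * y ^ m) * (zx ^ (2 * m) * zy ^ m) = 1] (mod h)"
  proof -
    have "[(x * zx) ^ (2 * m) * (y * zy) ^ m = 1 ^ (2 * m) * 1 ^ m] (mod h)"
      by (intro cong_mult cong_pow z)
    then show ?thesis by (simp add: power_mult_distrib mult_ac)
  qed
  have "x ^ (2 * m) * y ^ m * (x ^ (2 * n) * y ^ n) = x ^ (2 * (n + m)) * y ^ (n + m)"
    by (simp only: power_add distrib_left distrib_right mult_ac)
  also have "\<dots> = x ^ (2 * r) * y ^ r * ((x ^ q) ^ (2 * m) * (y ^ q) ^ m)"
    unfolding n power_mult[symmetric] by (simp only: power_add distrib_left distrib_right mult_ac)
  also have "[\<dots> = x ^ (2 * r) * y ^ r * (y ^ (2 * m) * x ^ m)] (mod h)"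
    by (intro cong_mult cong_refl cong_pow xq yq)
  finally have 1: "[x ^ (2 * m) * y ^ m * (x ^ (2 * n) * y ^ n) =
      x ^ (2 * r) * y ^ r * (y ^ (2 * m) * x ^ m)] (mod h)" .
  have "x ^ (2 * m) * y ^ m * (x ^ (2 * r + q - m) * y ^ (r + m - 1)) =
      x ^ q * (x ^ (2 * r + m) * y ^ (r + 2 * m - 1))"
  proof -
    have e: "2 * m + (2 * r + q - m) = q + (2 * r + m)" "m + (r + m - 1) = r + 2 * m - 1"
      using m rm by auto
    have "x ^ (2 * m) * y ^ m * (x ^ (2 * r + q - m) * y ^ (r + m - 1)) =
        x ^ (2 * m + (2 * r + q - m)) * y ^ (m + (r + m - 1))"
      by (simp only: power_add mult_ac)
    also have "\<dots> = x ^ q * (x ^ (2 * r + m) * y ^ (r + 2 * m - 1))"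
      unfolding e by (simp only: power_add mult_ac)
    finally show ?thesis .
  qed
  also have "[\<dots> = y * (x ^ (2 * r + m) * y ^ (r + 2 * m - 1))] (mod h)"
    by (intro cong_mult cong_refl xq)
  also have "y * (x ^ (2 * r + m) * y ^ (r + 2 * m - 1)) = x ^ (2 * r) * y ^ r * (y ^ (2 * m) * x ^ m)"
  proof -
    have "Suc (r + 2 * m - 1) = r + 2 * m" using rm by simp
    then have "y * y ^ (r + 2 * m - 1) = y ^ (r + 2 * m)" by (simp only: power_Suc[symmetric])
    then have "y * (x ^ (2 * r + m) * y ^ (r + 2 * m - 1)) = x ^ (2 * r + m) * y ^ (r + 2 * m)"
      by (subst mult.left_commute) (rule arg_cong)
    also have "\<dots> = x ^ (2 * r) * y ^ r * (y ^ (2 * m) * x ^ m)"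
      by (simp only: power_add mult_2 mult_ac)
    finally show ?thesis .
  qed
  finally have 2: "[x ^ (2 * m) * y ^ m * (x ^ (2 * r + q - m) * y ^ (r + m - 1)) =
      x ^ (2 * r) * y ^ r * (y ^ (2 * m) * x ^ m)] (mod h)" .
  have "[x ^ (2 * n) * y ^ n = x ^ (2 * r + q - m) * y ^ (r + m - 1)] (mod h)"
    by (rule cong_cancel_unit[OF z' cong_trans[OF 1 cong_sym[OF 2]]])
  then show ?thesis by (simp only: x_def y_def h_def q_def)
qed

text \<open>These are the terms of I and II, and of the first sum of III, after the substitutions \<open>t = 2 - s\<close>
  and \<open>t = 1 - s\<close>; the quantity \<open>m - 1 + t\<close> is \<open>\<alpha>\<close> resp. \<open>v - \<epsilon>\<close>.\<close>
definition rational_term :: "int \<Rightarrow> int \<Rightarrow> int \<Rightarrow> int" where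
  "rational_term q r t = binom_int r (t * (q - 1) - 2 * r)"

definition trace_term :: "int \<Rightarrow> int \<Rightarrow> int \<Rightarrow> int \<Rightarrow> int" where
  "trace_term q r m t = (-1) ^ nat \<bar>m - 1 + t\<bar> *
    binom_int (r + (m - 1 + t)) (t * (q - 1) - 2 * r + (m - 1 + t))"

lemma binom_int_of_nat: "binom_int (int a) (int b) = int (a choose b)"
  by (simp add: binom_int_def binomial_eq_0)

text \<open>After \<open>cong_shift_power\<close> the degree is at most \<open>3 r + q - 1\<close>,
  so four expansion terms suffice, and the \<open>t\<close>-th is \<open>trace_term\<close> at
  \<open>t\<close>.\<close>

lemma artin_trace_shift:
  assumes "odd CARD('a)" "n = r + m * (CARD('a) - 1)" "r < CARD('a) - 1" "m \<le> CARD('a)" "0 < n"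
  shows "artin_trace ([:0, 1:] ^ (2 * n) * [:1, -1:] ^ n) =
    (\<Sum>t<3. of_int (trace_term (int CARD('a)) (int r) (int m) (int t)) :: 'a::{field,finite})"
proof -
  define q where "q = CARD('a)"
  have q: "q \<ge> 3" "odd q" using card_field_ge_2[where 'a = 'a] assms(1)
    by (cases "q = 2"; simp add: q_def)+
  have r: "r < q - 1" and m: "m \<le> q" using assms by (simp_all add: q_def)
  have rm: "r + m \<ge> 1" using assms(2,5) by (cases m) auto
  define a b where "a = 2 * r + q - m" and "b = r + m - 1"
  let ?p = "[:0, 1:] ^ a * [:1, -1 :: 'a:] ^ b"
  have ab: "a + b = 3 * r + q - 1" using m rm by (simp add: a_def b_def)
  have "artin_trace ([:0, 1:] ^ (2 * n) * [:1, -1 :: 'a:] ^ n) = artin_trace ?p"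
    unfolding a_def b_def q_def by (intro artin_trace_cong cong_shift_power assms)
  also have "degree ?p + 1 < 4 * (q - 1)"
    using degree_X_one_minus_X[of a b, where 'a = 'a] ab r q by linarith
  then have "artin_trace ?p = (\<Sum>t<4. coeff (?p * [:1, -1:] ^ t) (q * Suc t - 1))"
    unfolding q_def by (rule artin_trace_eq_sum)
  also have "\<dots> = (\<Sum>t<4. of_int (trace_term (int q) (int r) (int m) (int t)))"
  proof (rule sum.cong[OF refl])
    fix t
    have "coeff (?p * [:1, -1:] ^ t) (q * Suc t - 1) =
        (if a \<le> q * Suc t - 1 then (-1) ^ (q * Suc t - 1 - a) * of_nat ((b + t) choose (q * Suc t - 1 - a)) else (0 :: 'a))"
      by (simp only: power_add[symmetric] mult.assoc coeff_X_one_minus_X)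
    also have "\<dots> = of_int (trace_term (int q) (int r) (int m) (int t))"
    proof -
      have top: "int r + (int m - 1 + int t) = int (b + t)" using rm by (simp add: b_def)
      have bot: "int t * (int q - 1) - 2 * int r + (int m - 1 + int t) = int (q * Suc t) - 1 - int a"
        using m by (simp add: a_def algebra_simps)
      show ?thesis
      proof (cases "a \<le> q * Suc t - 1")
        case True
        then have e: "int (q * Suc t) - 1 - int a = int (q * Suc t - 1 - a)" using q by simp
        \<comment> \<open>The two exponents differ by \<open>t (q - 1) - 2 r\<close>, which is even
          because \<open>q\<close> is odd.\<close>
        have "even (int (q * Suc t - 1 - a) - (int m - 1 + int t))"
          unfolding e[symmetric] bot[symmetric] using q by simp
        then have "even (q * Suc t - 1 - a) = even (nat \<bar>int m - 1 + int t\<bar>)"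
          by (simp add: even_nat_iff)
        then have "(-1 :: int) ^ nat \<bar>int m - 1 + int t\<bar> = (-1) ^ (q * Suc t - 1 - a)"
          by (simp add: minus_one_power_iff)
        then show ?thesis using True
          by (simp add: trace_term_def top bot e binom_int_of_nat del: of_nat_mult of_nat_add mult_Suc_right)
      next
        case False
        then have "q * Suc t \<le> a" by linarith
        then have "int (q * Suc t) \<le> int a" by (simp only: of_nat_le_iff)
        then have "int (q * Suc t) - 1 - int a < 0" by linarith
        then show ?thesis using False by (simp only: trace_term_def top bot) (simp add: binom_int_def)
      qed
    qed
    finally show "coeff (?p * [:1, -1:] ^ t) (q * Suc t - 1) =
      (of_int (trace_term (int q) (int r) (int m) (int t)) :: 'a)" .
  qed
  \<comment> \<open>At \<open>t = 3\<close> the lower index exceeds the upper one, since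
    \<open>r < q - 1\<close>.\<close>
  also have "\<dots> = (\<Sum>t<3. of_int (trace_term (int q) (int r) (int m) (int t)))"
  proof -
    have "int r + 1 < int q" using r by linarith
    then have "\<not> 3 * (int q - 1) - 2 * int r + (int m - 1 + 3) \<le> int r + (int m - 1 + 3)"
      by simp
    then have "trace_term (int q) (int r) (int m) 3 = 0"
      by (simp only: trace_term_def binom_int_def if_False simp_thms mult_zero_right)
    then show ?thesis by (simp add: eval_nat_numeral)
  qed
  finally show ?thesis by (simp add: q_def)
qed

text \<open>On the field \<open>x^n\<close> depends only on the residue of \<open>n > 0\<close>
  modulo \<open>q - 1\<close>. With the reduced exponent, only the coefficients at
  \<open>q - 1\<close>, \<open>2 (q - 1)\<close> and \<open>3 (q - 1)\<close> enter.\<close>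

lemma sum_rational:
  assumes "odd CARD('a)" "n = r + m * (CARD('a) - 1)" "r < CARD('a) - 1" "0 < n"
  shows "(\<Sum>x\<in>UNIV. x ^ (2 * n) * (1 - x) ^ n) = - of_nat (delta CARD('a) n) -
    (\<Sum>t<3. of_int (rational_term (int CARD('a)) (int r) (int t)) :: 'a::{field,finite})"
proof -
  define q where "q = CARD('a)"
  have q: "q \<ge> 3" "odd q" using card_field_ge_2[where 'a = 'a] assms(1)
    by (cases "q = 2"; simp add: q_def)+
  have r: "r < q - 1" using assms by (simp add: q_def)
  have nr: "n mod (q - 1) = r" using r assms(2) by (simp add: q_def)
  \<comment> \<open>Residue 0 is represented by \<open>q - 1\<close>, since \<open>x^0\<close> would
    give the wrong value at \<open>x = 0\<close>.\<close>
  define s where "s = (if r = 0 then q - 1 else r)"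
  have s: "s > 0" using q by (simp add: s_def)
  have "[n = s] (mod (q - 1))" using nr r by (simp add: s_def cong_def)
  then have ns: "x ^ n = x ^ s" for x :: 'a
    unfolding q_def by (rule power_cong_finite_field) (use assms s in auto)
  let ?p = "[:0, 1:] ^ (2 * s) * [:1, -1 :: 'a:] ^ s"
  have "x ^ (2 * n) * (1 - x) ^ n = poly ?p x" for x :: 'a
    by (simp add: mult.commute[of 2] power_mult ns poly_power)
  then have S: "(\<Sum>x\<in>UNIV. x ^ (2 * n) * (1 - x) ^ n) = (\<Sum>x\<in>UNIV. poly ?p x)" by simp
  have "degree ?p \<le> 3 * s" using degree_X_one_minus_X[of "2 * s" s, where 'a = 'a] by simp
  also have "3 * s < Suc 3 * (q - 1)" using r q by (simp add: s_def)
  finally have "(\<Sum>x\<in>UNIV. poly ?p x) = - (\<Sum>k=1..3. coeff ?p (k * (q - 1)))"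
    unfolding q_def by (rule sum_poly_finite_field)
  also have "(\<Sum>k=1..3. coeff ?p (k * (q - 1))) =
      of_nat (delta q n) + (\<Sum>t<3. of_int (rational_term (int q) (int r) (int t)))"
  proof (cases "r = 0")
    case True
    \<comment> \<open>The total 2 is one more than the sum of the rational terms, and
      \<open>delta\<close> accounts for the difference.\<close>
    have "coeff ?p (1 * (q - 1)) = 0" "coeff ?p (2 * (q - 1)) = 1" "coeff ?p (3 * (q - 1)) = 1"
      using True q by (simp_all only: coeff_X_one_minus_X) (auto simp: s_def)
    then have "(\<Sum>k=1..3. coeff ?p (k * (q - 1))) = 2" by (simp add: eval_nat_numeral)
    moreover have "rational_term (int q) 0 0 = 1" "rational_term (int q) 0 1 = 0" "rational_term (int q) 0 2 = 0"
      using q by (simp_all add: rational_term_def binom_int_def)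
    ultimately show ?thesis using nr True by (simp add: delta_def eval_nat_numeral)
  next
    case False
    have c: "coeff ?p (k * (q - 1)) = of_int (rational_term (int q) (int r) (int k))" for k
    proof (cases "2 * r \<le> k * (q - 1)")
      case True
      have "int k * (int q - 1) - 2 * int r = int (k * (q - 1) - 2 * r)"
        using True q by (simp add: of_nat_diff)
      moreover have "even (k * (q - 1) - 2 * r)" using q by simp
      ultimately show ?thesis using True False
        by (simp only: coeff_X_one_minus_X rational_term_def binom_int_of_nat) (simp add: s_def)
    next
      case False': False
      have "int (k * (q - 1)) < int (2 * r)" using False' by (simp only: of_nat_less_iff)
      then have "int k * (int q - 1) - 2 * int r < 0" using q by (simp add: of_nat_diff)
      then show ?thesis using False' False
        by (simp only: coeff_X_one_minus_X rational_term_def binom_int_def) (simp add: s_def)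
    qed
    \<comment> \<open>Hence summing over \<open>k\<close> from 1 to 3 or over \<open>t\<close> from
      0 to 2 makes no difference.\<close>
    have "rational_term (int q) (int r) 0 = 0" "rational_term (int q) (int r) 3 = 0"
      using False r by (auto simp: rational_term_def binom_int_def)
    then show ?thesis using False nr
      by (simp only: c) (simp add: delta_def eval_nat_numeral)
  qed
  finally show ?thesis unfolding S by (simp add: q_def)
qed

subsection \<open>The sums I, II and III\<close>

lemma ratio_interval:
  assumes "q > 1"
  shows "ratio q u v < of_int k \<longleftrightarrow> (u + v) div (q - 1) < k"
    and "of_int k \<le> ratio q u v + 1 \<longleftrightarrow> k \<le> (u + v) div (q - 1) + 1"
proof -
  have f: "\<lfloor>ratio q u v\<rfloor> = (u + v) div (q - 1)"
    unfolding ratio_def by (rule floor_divide_of_int_eq)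
  show "ratio q u v < of_int k \<longleftrightarrow> (u + v) div (q - 1) < k"
    by (simp add: floor_less_iff flip: f)
  have "of_int k \<le> ratio q u v + 1 \<longleftrightarrow> of_int (k - 1) \<le> ratio q u v" by (simp add: algebra_simps)
  also have "\<dots> \<longleftrightarrow> k - 1 \<le> \<lfloor>ratio q u v\<rfloor>" by (simp only: le_floor_iff)
  finally show "of_int k \<le> ratio q u v + 1 \<longleftrightarrow> k \<le> (u + v) div (q - 1) + 1"
    unfolding f by linarith
qed

context
  fixes q u v r f m :: int
  assumes q: "q > 1"
    and r: "r = (u + v) mod (q - 1)"
    and f: "f = (u + v) div (q - 1)"
    and m: "m = v + f"
begin

text \<open>A half-open interval of length one contains exactly one integer. This is what collapses
  the summation ranges.\<close>

lemma window:
  "ratio q u v < of_int k \<and> of_int k \<le> ratio q u v + 1 \<longleftrightarrow> k = f + 1"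
  unfolding ratio_interval[OF q] f by linarith

lemma window_shifted:
  "of_int v - of_int q + ratio q u v < of_int s \<and> of_int s \<le> of_int v - of_int q + ratio q u v + 1
    \<longleftrightarrow> s = m - q + 1"
  using window[of "s - v + q"] m by (auto simp: algebra_simps)

text \<open>Adding \<open>v (q - 1)\<close> gives \<open>u + v q = r + m (q - 1)\<close>: thus
  \<open>m\<close> and \<open>r\<close> are quotient and remainder of \<open>u + v q\<close> by
  \<open>q - 1\<close>.\<close>

lemma uv: "u + v = r + f * (q - 1)"
  unfolding r f by (rule mod_div_mult_eq[symmetric])

lemma termI_eq: "termI q u v (m - q + 1) = rational_term q r (q + 1 - m)"
proof -
  have "u + v - (m - q + 1 - v + q - 1) * (q - 1) = r"
    using uv by (simp add: m algebra_simps)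
  moreover have "(m - q + 1 - 2 * v + 2 * q) * (q - 1) - 2 * (u + v) = (q + 1 - m) * (q - 1) - 2 * r"
    unfolding uv by (simp add: m algebra_simps)
  ultimately show ?thesis by (simp only: termI_def rational_term_def)
qed

text \<open>Only \<open>s = m - q + 1\<close> can occur, and the bound \<open>-1 < s\<close> reads
  \<open>m >= q - 1\<close>.\<close>

lemma sumI_eq: "sumI q u v = (if m \<ge> q - 1 then rational_term q r (q + 1 - m) else 0)"
proof -
  have "{s::int. max (-1) (of_int v - of_int q + ratio q u v) < of_int s \<and>
      of_int s \<le> of_int v - of_int q + ratio q u v + 1} = (if m \<ge> q - 1 then {m - q + 1} else {})"
    using window_shifted by (auto simp del: of_int_diff)
  then show ?thesis by (simp add: sumI_def Let_def termI_eq)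
qed

text \<open>For each \<open>s\<close> the window forces \<open>\<alpha> = m + 1 - s\<close>, that is
  \<open>m - 1 + t\<close> with \<open>t = 2 - s\<close>; the bounds on \<open>\<alpha>\<close> that
  remain are the condition on \<open>t\<close>.\<close>

lemma sumII_eq: "sumII q u v =
  (\<Sum>t\<in>{0, 1, 2}. if 1 \<le> m - 1 + t \<and> m - 1 + t \<le> q - 1 then rational_term q r t else 0)"
proof -
  let ?g = "\<lambda>(s, \<alpha>). binom_int (u + v - (s + \<alpha> - v - 1) * (q - 1)) ((s + 2*\<alpha> - 2*v) * (q - 1) - 2 * (u + v))"
  let ?T = "{t \<in> {0, 1, 2}. 1 \<le> m - 1 + t \<and> m - 1 + t \<le> q - 1}"
  have w: "of_int v - of_int s + ratio q u v < of_int a \<and> of_int a \<le> of_int v - of_int s + ratio q u v + 1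
      \<longleftrightarrow> a = m + 1 - s" for s a
    using window[of "a + s - v"] m by (auto simp: algebra_simps)
  have q1: "(of_int a :: rat) \<le> of_int q - 1 \<longleftrightarrow> a \<le> q - 1" for a
    by (metis of_int_1 of_int_diff of_int_le_iff)
  have "{(s::int, \<alpha>::int). 0 \<le> s \<and> s \<le> 2 \<and>
         max 0 (of_int v - of_int s + ratio q u v) < of_int \<alpha> \<and>
         of_int \<alpha> \<le> min (of_int q - 1) (of_int v - of_int s + ratio q u v + 1)} =
      {(s, \<alpha>). 0 \<le> s \<and> s \<le> 2 \<and> 0 < \<alpha> \<and> \<alpha> \<le> q - 1 \<and> \<alpha> = m + 1 - s}"
    unfolding max_less_iff_conj min.bounded_iff q1 of_int_0_less_iff w[symmetric] by blast
  also have "\<dots> = (\<lambda>t. (2 - t, m - 1 + t)) ` ?T"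
    by (force simp: image_iff)
  finally have "sumII q u v = (\<Sum>t\<in>?T. ?g (2 - t, m - 1 + t))"
    by (simp only: sumII_def Let_def) (subst sum.reindex, auto simp: inj_on_def)
  also have "\<dots> = (\<Sum>t\<in>?T. rational_term q r t)"
  proof (rule sum.cong[OF refl])
    fix t
    have "u + v - (2 - t + (m - 1 + t) - v - 1) * (q - 1) = r"
      using uv by (simp add: m algebra_simps)
    moreover have "(2 - t + 2 * (m - 1 + t) - 2 * v) * (q - 1) - 2 * (u + v) = t * (q - 1) - 2 * r"
      unfolding uv by (simp add: m algebra_simps)
    ultimately show "?g (2 - t, m - 1 + t) = rational_term q r t"
      by (simp only: rational_term_def prod.case)
  qed
  also have "\<dots> = (\<Sum>t\<in>{0, 1, 2}. if 1 \<le> m - 1 + t \<and> m - 1 + t \<le> q - 1 then rational_term q r t else 0)"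
    by (rule sum.inter_filter) simp
  finally show ?thesis .
qed

text \<open>In the double sum \<open>\<epsilon> = s - f\<close> is forced, so
  \<open>v - \<epsilon> = m - 1 + t\<close> with \<open>t = 1 - s\<close>. In the single sum
  \<open>s = m - q + 1\<close> must lie in \<open>{-1, 0, 1}\<close>.\<close>

lemma sumIII_eq: "sumIII q u v =
  (\<Sum>t\<in>{0, 1, 2}. if 1 \<le> m - 1 + t \<and> m - 1 + t \<le> q - 1 then trace_term q r m t else 0) -
  (if q - 2 \<le> m \<and> m \<le> q then rational_term q r (q + 1 - m) else 0)"
proof -
  let ?g = "\<lambda>(s, \<epsilon>). (-1) ^ nat \<bar>v + \<epsilon>\<bar> *
        binom_int (u + 2*v - (s - \<epsilon>) * (q - 1) - \<epsilon>) ((s - 2*\<epsilon> + 1) * (q - 1) - 2*u - v - \<epsilon>)"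
  let ?T = "{t \<in> {0, 1, 2}. 1 \<le> m - 1 + t \<and> m - 1 + t \<le> q - 1}"
  \<comment> \<open>This interval is closed below and open above; passing to
    \<open>s - e + 1\<close> reverses it into the form of \<open>window\<close>.\<close>
  have w: "of_int s - ratio q u v \<le> of_int e \<and> of_int e < of_int s - ratio q u v + 1
      \<longleftrightarrow> e = s - f" for s e
  proof -
    have "(of_int (s - e + 1) :: rat) = of_int s - of_int e + 1" by simp
    then have "of_int s - ratio q u v \<le> of_int e \<and> of_int e < of_int s - ratio q u v + 1 \<longleftrightarrow>
        ratio q u v < of_int (s - e + 1) \<and> of_int (s - e + 1) \<le> ratio q u v + 1"
      by linarith
    also have "\<dots> \<longleftrightarrow> e = s - f" unfolding window by linarith
    finally show ?thesis .
  qed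
  have q1: "of_int v - of_int q + 1 \<le> (of_int e :: rat) \<longleftrightarrow> v - q + 1 \<le> e" for e
    using of_int_le_iff[of "v - q + 1" e, where 'a = rat] by simp
  let ?A = "{(s::int, \<epsilon>::int). -1 \<le> s \<and> s \<le> 1 \<and>
         max (of_int s - ratio q u v) (of_int v - of_int q + 1) \<le> of_int \<epsilon> \<and>
         of_int \<epsilon> < min (of_int s - ratio q u v + 1) (of_int v)}"
  have "?A = {(s, \<epsilon>). -1 \<le> s \<and> s \<le> 1 \<and> v - q + 1 \<le> \<epsilon> \<and> \<epsilon> < v \<and> \<epsilon> = s - f}"
    unfolding max.bounded_iff min_less_iff_conj q1 of_int_less_iff w[symmetric] by blast
  also have "\<dots> = (\<lambda>t. (1 - t, 1 - t - f)) ` ?T"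
  proof (intro set_eqI iffI; clarify)
    fix s
    assume "-1 \<le> s" "s \<le> 1" "v - q + 1 \<le> s - f" "s - f < v"
    then show "(s, s - f) \<in> (\<lambda>t. (1 - t, 1 - t - f)) ` ?T"
      by (intro image_eqI[of _ _ "1 - s"]) (auto simp: m)
  next
    fix t
    assume "t \<in> {0, 1, 2}" "1 \<le> m - 1 + t" "m - 1 + t \<le> q - 1"
    then show "-1 \<le> 1 - t \<and> 1 - t \<le> 1 \<and> v - q + 1 \<le> 1 - t - f \<and> 1 - t - f < v \<and>
        1 - t - f = 1 - t - f"
      by (auto simp: m)
  qed
  finally have A: "?A = (\<lambda>t. (1 - t, 1 - t - f)) ` ?T" .
  have "sum ?g ?A = (\<Sum>t\<in>?T. trace_term q r m t)"
  proof (rule sum.reindex_cong[OF _ A])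
    show "inj_on (\<lambda>t. (1 - t, 1 - t - f)) ?T" by (rule inj_onI) simp
    fix t
    have "u + 2 * v - (1 - t - (1 - t - f)) * (q - 1) - (1 - t - f) = r + (m - 1 + t)"
      using uv by (simp add: m algebra_simps)
    moreover have "(1 - t - 2 * (1 - t - f) + 1) * (q - 1) - 2 * u - v - (1 - t - f) =
        t * (q - 1) - 2 * r + (m - 1 + t)"
    proof -
      have "(1 - t - 2 * (1 - t - f) + 1) * (q - 1) - 2 * u - v - (1 - t - f) =
          (2 * f + t) * (q - 1) - 2 * (u + v) + (m - 1 + t)"
        by (simp add: m algebra_simps)
      also have "\<dots> = t * (q - 1) - 2 * r + (m - 1 + t)"
        unfolding uv by (simp add: algebra_simps)
      finally show ?thesis .
    qed
    moreover have "(-1 :: int) ^ nat \<bar>v + (1 - t - f)\<bar> = (-1) ^ nat \<bar>m - 1 + t\<bar>"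
    proof -
      have "even (v + (1 - t - f)) = even (m - 1 + t)" unfolding m by presburger
      then show ?thesis by (simp only: minus_one_power_iff even_nat_iff abs_ge_zero even_abs_add_iff dvd_abs_iff)
    qed
    ultimately show "?g (1 - t, 1 - t - f) = trace_term q r m t"
      by (simp only: trace_term_def prod.case)
  qed
  also have "\<dots> = (\<Sum>t\<in>{0, 1, 2}. if 1 \<le> m - 1 + t \<and> m - 1 + t \<le> q - 1 then trace_term q r m t else 0)"
    by (rule sum.inter_filter) simp
  finally have 1: "sum ?g ?A = \<dots>" .
  have s2: "-2 < (of_int s :: rat) \<longleftrightarrow> -2 < s" "(of_int s :: rat) \<le> 1 \<longleftrightarrow> s \<le> 1" for s
    using of_int_less_iff[of "-2" s, where 'a = rat] by simp_all
  have "{s::int. max (-2) (of_int v - of_int q + ratio q u v) < of_int s \<and>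
      of_int s \<le> min 1 (of_int v - of_int q + ratio q u v + 1)} =
      {s. -2 < s \<and> s \<le> 1 \<and> s = m - q + 1}"
    unfolding max_less_iff_conj min.bounded_iff s2 window_shifted[symmetric] by blast
  also have "\<dots> = (if q - 2 \<le> m \<and> m \<le> q then {m - q + 1} else {})" by auto
  finally have 2: "(\<Sum>s\<in>{s::int. max (-2) (of_int v - of_int q + ratio q u v) < of_int s \<and>
      of_int s \<le> min 1 (of_int v - of_int q + ratio q u v + 1)}. termI q u v s) =
      (if q - 2 \<le> m \<and> m \<le> q then rational_term q r (q + 1 - m) else 0)"
    by (simp add: termI_eq)
  show ?thesis using 1 2 by (simp only: sumIII_def Let_def prod.case)
qed

end

text \<open>Lucas' step for integer lower indices; the convention that out-of-range coefficients are
  0 absorbs the case distinction.\<close>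

lemma binom_int_card_add:
  assumes "0 \<le> a"
  shows "(of_int (binom_int (int CARD('a) + a) k) :: 'a::{field,finite}) =
    of_int (binom_int a k) + of_int (binom_int a (k - int CARD('a)))"
proof -
  obtain b where b: "a = int b" using assms by (metis nonneg_int_cases)
  have top: "int CARD('a) + a = int (CARD('a) + b)" by (simp add: b)
  consider "k < 0" | j where "k = int j" by (metis linorder_not_less nonneg_int_cases)
  then show ?thesis
  proof cases
    case 1
    then show ?thesis by (simp add: binom_int_def)
  next
    case 2
    have "binom_int a (k - int CARD('a)) = (if CARD('a) \<le> j then int (b choose (j - CARD('a))) else 0)"
      using 2 by (auto simp: b simp flip: of_nat_diff binom_int_of_nat) (simp add: binom_int_def)
    then show ?thesis
      unfolding top 2 unfolding b binom_int_of_nat by (simp add: binomial_card_add)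
  qed
qed

lemma binom_int_pascal:
  assumes "0 \<le> a"
  shows "binom_int (a + 1) (k + 1) = binom_int a (k + 1) + binom_int a k"
proof -
  obtain b where b: "a = int b" using assms by (metis nonneg_int_cases)
  consider "k < -1" | "k = -1" | j where "k = int j"
    by (metis add.commute add_neg_numeral_special(7) linorder_neqE_linordered_idom nonneg_int_cases not_less zle_add1_eq_le)
  then show ?thesis
  proof cases
    case 3
    have "a + 1 = int (Suc b)" "k + 1 = int (Suc j)" by (simp_all add: b 3)
    then show ?thesis unfolding b 3 binom_int_of_nat by (metis binom_int_of_nat binomial_Suc_Suc add.commute of_nat_add)
  qed (use assms in \<open>simp_all add: binom_int_def\<close>)
qed

subsection \<open>Assembling the formula\<close>

lemma trace_term_eq_rational_term: "m - 1 + t = 0 \<Longrightarrow> trace_term q r m t = rational_term q r t"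
  by (simp add: trace_term_def rational_term_def)

text \<open>The ranges in I, II and III omit some \<open>t\<close>. Only \<open>m - 1 + t \<in> {-1, 0, q, q + 1}\<close> can be omitted,
  and those terms match by Lucas' congruence; for \<open>m = q\<close> the terms \<open>t = 1\<close> and \<open>t = 2\<close> do so only jointly.\<close>
lemma edge_terms_cancel:
  fixes r m :: int
  assumes "odd CARD('a)" "0 \<le> r" "r < int CARD('a) - 1" "0 \<le> m" "m \<le> int CARD('a)"
    and "m = 0 \<Longrightarrow> r > 0"
  defines "q \<equiv> int CARD('a)"
  defines "X \<equiv> rational_term q r" and "Y \<equiv> trace_term q r m"
  shows "(\<Sum>t\<in>{0, 1, 2}. of_int (Y t)) - (\<Sum>t\<in>{0, 1, 2}. of_int (X t)) =
    (- of_int (if m \<ge> q - 1 then X (q + 1 - m) else 0)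
     - of_int (\<Sum>t\<in>{0, 1, 2}. if 1 \<le> m - 1 + t \<and> m - 1 + t \<le> q - 1 then X t else 0)
     + of_int ((\<Sum>t\<in>{0, 1, 2}. if 1 \<le> m - 1 + t \<and> m - 1 + t \<le> q - 1 then Y t else 0)
         - (if q - 2 \<le> m \<and> m \<le> q then X (q + 1 - m) else 0)) :: 'a::{field,finite})"
proof -
  have q: "q \<ge> 3" using card_field_ge_2[where 'a = 'a] assms(1)
    by (cases "CARD('a) = 2"; simp add: q_def)
  have q_odd: "odd (nat q)" using assms(1) by (simp add: q_def)
  have r: "0 \<le> r" "r < q - 1" and m: "0 \<le> m" "m \<le> q" using assms(2-5) by (simp_all add: q_def)
  have X3: "X 3 = 0" using r by (simp add: X_def rational_term_def binom_int_def)
  \<comment> \<open>The range of the single sum in III also admits \<open>m = q - 2\<close>, but its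
    term there is \<open>X 3 = 0\<close>. So I and III subtract the same term, which altogether is
    removed twice.\<close>
  have last: "(if q - 2 \<le> m \<and> m \<le> q then X (q + 1 - m) else 0) = (if m \<ge> q - 1 then X (q + 1 - m) else 0)"
  proof (cases "m = q - 2")
    case True
    then have "q + 1 - m = 3" by simp
    then show ?thesis using X3 True by (simp only: if_cancel)
  qed (use m in auto)
  have zero: "Y t = X t" if "m - 1 + t = 0" for t
    unfolding X_def Y_def using that by (rule trace_term_eq_rational_term)
  have lucas: "(of_int (binom_int (q + a) (k + q)) :: 'a) = of_int (binom_int a (k + q)) + of_int (binom_int a k)"
    if "0 \<le> a" for a k
    unfolding q_def using binom_int_card_add[OF that, of "k + int CARD('a)", where 'a = 'a] by simp
  consider "m = 0" | "m = 1" | "2 \<le> m" "m \<le> q - 2" | "m = q - 1" | "m = q"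
    using m by linarith
  then show ?thesis
  proof cases
    case 1
    \<comment> \<open>Positive \<open>r\<close> makes both lower indices at \<open>t = 0\<close>
      negative.\<close>
    then have "r > 0" using assms(6) by simp
    then have "X 0 = 0" "Y 0 = 0"
      using 1 by (simp_all add: X_def Y_def rational_term_def trace_term_def binom_int_def)
    moreover have "Y 1 = X 1" using zero[of 1] 1 by simp
    ultimately show ?thesis unfolding last using 1 q by simp
  next
    case 2
    have "Y 0 = X 0" using zero[of 0] 2 by simp
    then show ?thesis unfolding last using 2 q by simp
  next
    case 3
    then show ?thesis unfolding last using q by simp
  next
    case 4
    have "Y 2 = - binom_int (q + r) (2 * (q - 1) - 2 * r + q)"
      using q_odd q 4 by (simp add: Y_def trace_term_def add.commute)
    moreover have "binom_int r (2 * (q - 1) - 2 * r + q) = 0"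
      using r q by (simp add: binom_int_def)
    \<comment> \<open>The omitted difference \<open>Y 2 - X 2\<close> is therefore
      \<open>-2 X 2\<close>, exactly what I and the single sum of III supply.\<close>
    ultimately have "(of_int (Y 2) :: 'a) = - of_int (X 2)"
      by (simp only: X_def rational_term_def of_int_minus lucas[OF r(1)]) simp
    then show ?thesis unfolding last using 4 q by simp
  next
    case 5
    have Y1: "Y 1 = - binom_int (q + r) (1 * (q - 1) - 2 * r + q)"
      using q_odd q 5 by (simp add: Y_def trace_term_def add.commute)
    have "Y 2 = binom_int (q + (r + 1)) ((2 * (q - 1) - 2 * r + 1) + q)"
    proof -
      have "even (nat \<bar>m - 1 + 2\<bar>)" using q_odd q by (simp add: 5 nat_add_distrib)
      moreover have "r + (m - 1 + 2) = q + (r + 1)"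
        "2 * (q - 1) - 2 * r + (m - 1 + 2) = (2 * (q - 1) - 2 * r + 1) + q" using 5 by simp_all
      ultimately show ?thesis
        unfolding Y_def trace_term_def by (simp only: minus_one_power_iff if_True mult_1)
    qed
    moreover have "binom_int (r + 1) (2 * (q - 1) - 2 * r + 1 + q) = 0"
      using r q by (simp add: binom_int_def)
    ultimately have Y2: "(of_int (Y 2) :: 'a) = of_int (binom_int (r + 1) (2 * (q - 1) - 2 * r + 1))"
      using r(1) by (simp only: lucas[of "r + 1"]) simp
    have e: "1 * (q - 1) - 2 * r + q = 2 * (q - 1) - 2 * r + 1" by simp
    \<comment> \<open>With \<open>B = binom_int r (2 (q - 1) - 2 r + 1)\<close>, Lucas gives
      \<open>Y 1 = - B - X 1\<close>, and Lucas with Pascal gives \<open>Y 2 = B + X 2\<close>;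
      \<open>B\<close> cancels only in the sum.\<close>
    have "(of_int (X 1) + of_int (Y 1) - of_int (X 2) + of_int (Y 2) :: 'a) = 0"
      unfolding Y1 Y2 binom_int_pascal[OF r(1)] of_int_minus lucas[OF r(1)] X_def rational_term_def
      unfolding e by simp
    then show ?thesis unfolding last using 5 q by (simp add: algebra_simps)
  qed
qed

text \<open>The cube splits as \<open>g(X) + g(1 - X)\<close>. The sum over the field and the trace
  are both invariant under the reflection, so the two halves contribute equally and the factor 2
  from \<open>two_times_sum_poly\<close> cancels.\<close>

lemma sum_rev_dickson_cubed:
  fixes n :: nat
  assumes "odd CARD('a)"
  defines "x \<equiv> [:0, 1 :: 'a::{field,finite}:]" and "y \<equiv> [:1, -1:]"
  shows "(\<Sum>a\<in>UNIV. rev_dickson_eval n a ^ 3) =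
    (\<Sum>a\<in>UNIV. a ^ (3 * n)) + artin_trace (x ^ (3 * n)) +
    3 * ((\<Sum>a\<in>UNIV. a ^ (2 * n) * (1 - a) ^ n) + artin_trace (x ^ (2 * n) * y ^ n))"
proof -
  define F where "F = (map_poly of_int (rev_dickson n) :: 'a poly) ^ 3"
  define g where "g = x ^ (3 * n) + smult 3 (x ^ (2 * n) * y ^ n)"
  have Fx: "pcompose F [:0, 1, -1:] = (x ^ n + y ^ n) ^ 3"
    unfolding F_def x_def y_def pcompose_power pcompose_map_rev_dickson ..
  have refl: "pcompose x y = y" "pcompose y y = x"
    by (simp_all add: x_def y_def pcompose_pCons)
  have "(x ^ n + y ^ n) ^ 3 = g + pcompose g y"
  proof -
    have 3: "smult 3 p = 3 * p" for p :: "'a poly" by (simp add: numeral_poly)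
    have "g + pcompose g y = (x ^ n) ^ 3 + smult 3 ((x ^ n)\<^sup>2 * y ^ n)
        + ((y ^ n) ^ 3 + smult 3 ((y ^ n)\<^sup>2 * x ^ n))"
      by (simp add: g_def pcompose_add pcompose_mult pcompose_power pcompose_smult refl
          mult.commute[of _ n] power_mult)
    then show ?thesis
      unfolding 3 by (simp add: power3_eq_cube power2_eq_square algebra_simps)
  qed
  then have f: "pcompose F [:0, 1, -1:] = g + pcompose g y" using Fx by simp
  have "(\<Sum>a\<in>UNIV. poly (pcompose g y) a) = (\<Sum>a\<in>UNIV. poly g a)"
    by (rule sum.reindex_bij_witness[of _ "\<lambda>a. 1 - a" "\<lambda>a. 1 - a"]) (auto simp: poly_pcompose y_def)
  moreover have "artin_trace (pcompose g y) = artin_trace g"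
    unfolding y_def by (rule artin_trace_reflect[OF assms(1)])
  ultimately have "2 * (\<Sum>a\<in>UNIV. poly F a) = 2 * ((\<Sum>a\<in>UNIV. poly g a) + artin_trace g)"
    unfolding two_times_sum_poly[OF assms(1), of F] f
    by (simp add: artin_trace_add sum.distrib)
  then have "(\<Sum>a\<in>UNIV. poly F a) = (\<Sum>a\<in>UNIV. poly g a) + artin_trace g"
    using two_nonzero[OF assms(1)] by (simp only: mult_cancel_left) blast
  moreover have "poly F a = rev_dickson_eval n a ^ 3" for a
    by (simp add: F_def rev_dickson_eval_def poly_power)
  moreover have "poly g a = a ^ (3 * n) + 3 * (a ^ (2 * n) * (1 - a) ^ n)" for a
    by (simp add: g_def x_def y_def poly_power)
  moreover have "artin_trace g = artin_trace (x ^ (3 * n)) + 3 * artin_trace (x ^ (2 * n) * y ^ n)"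
    by (simp add: g_def artin_trace_add artin_trace_smult)
  ultimately show ?thesis by (simp add: sum.distrib sum_distrib_left distrib_left)
qed

theorem theorem4p5:
  fixes n u v u' v' :: nat
  assumes q_odd: "odd (card (UNIV :: 'a::{field,finite} set))"
    and n_ge: "1 \<le> n" and n_le: "n \<le> CARD('a)^2 - 2"
    and uv: "n = u + v * CARD('a)" "u \<le> CARD('a) - 1" "v \<le> CARD('a) - 1"
    and uv': "3 * n mod (CARD('a)^2 - 1) = (u' + v' * CARD('a)) mod (CARD('a)^2 - 1)"
             "u' \<le> CARD('a) - 1" "v' \<le> CARD('a) - 1" "0 < u' + v' * CARD('a)"
  shows "(\<Sum>a\<in>(UNIV::'a set). rev_dickson_eval n a ^ 3) =
    3 * (- of_nat (delta CARD('a) n)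
         - of_int (sumI (int (CARD('a))) (int u) (int v))
         - of_int (sumII (int (CARD('a))) (int u) (int v))
         + of_int (sumIII (int (CARD('a))) (int u) (int v)))
    + (if u' + v' * CARD('a) \<le> CARD('a)^2 - 2
       then - (inverse (2::'a) ^ (u' + v') * of_nat ((u' + v') choose (CARD('a) - 1)))
            + of_int (binom_int (2 * (int (CARD('a)) - 1) - int u' - int v') (int (CARD('a)) - 1 - int u'))
       else -1)"
proof -
  define q where "q = CARD('a)"
  have q: "q \<ge> 3" "odd q" using card_field_ge_2[where 'a = 'a] q_odd
    by (cases "q = 2"; simp add: q_def)+
  define r f m where "r = (u + v) mod (q - 1)" and "f = (u + v) div (q - 1)" and "m = v + f"
  have r: "r < q - 1" using q by (simp add: r_def)
  have uv_q: "u + v = r + f * (q - 1)" unfolding r_def f_def by (rule mod_div_mult_eq[symmetric])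
  have n: "n = r + m * (q - 1)"
  proof -
    have "v * q = v + v * (q - 1)" using q by (cases q) simp_all
    then show ?thesis using uv(1) uv_q by (simp add: q_def[symmetric] m_def add_mult_distrib)
  qed
  \<comment> \<open>Since \<open>q^2 - 1 = (q + 1) (q - 1)\<close>, the value
    \<open>m = q + 1\<close> would already exceed the bound on \<open>n\<close>.\<close>
  have m: "m \<le> q"
  proof (rule ccontr)
    assume "\<not> m \<le> q"
    then have "(q + 1) * (q - 1) \<le> m * (q - 1)" by (intro mult_le_mono1) simp
    moreover have "(q + 1) * (q - 1) = q\<^sup>2 - 1" using q by (cases q) (simp_all add: power2_eq_square)
    moreover have "q\<^sup>2 \<ge> 9" using power_mono[OF q(1), of 2] by simp
    ultimately show False using n n_le[folded q_def] by linarith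
  qed
  have qn1: "int q > 1" "int (q - 1) = int q - 1" using q by auto
  have ints: "int r = (int u + int v) mod (int q - 1)" "int f = (int u + int v) div (int q - 1)"
    "int m = int v + int f"
    unfolding qn1(2)[symmetric] by (simp_all add: r_def f_def m_def zmod_int zdiv_int)
  note sums = sumI_eq[OF qn1(1) ints] sumII_eq[OF qn1(1) ints] sumIII_eq[OF qn1(1) ints]
  have lt3: "(\<Sum>t<3. h (int t)) = (\<Sum>t\<in>{0, 1, 2}. h t)" for h :: "int \<Rightarrow> 'a"
    by (simp add: eval_nat_numeral)
  have "m = 0 \<Longrightarrow> 0 < r" using n n_ge by auto
  then have edge: "(\<Sum>t<3. of_int (trace_term (int q) (int r) (int m) (int t))) -
      (\<Sum>t<3. of_int (rational_term (int q) (int r) (int t))) =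
      (- of_int (sumI (int q) (int u) (int v)) - of_int (sumII (int q) (int u) (int v))
       + of_int (sumIII (int q) (int u) (int v)) :: 'a)"
    unfolding sums lt3[of "\<lambda>t. of_int (trace_term (int q) (int r) (int m) t)"]
      lt3[of "\<lambda>t. of_int (rational_term (int q) (int r) t)"]
    unfolding q_def
    by (intro edge_terms_cancel q_odd) (use r m in \<open>simp_all add: q_def\<close>)
  have n_pos: "0 < n" using n_ge by simp
  have "(\<Sum>a\<in>UNIV. a ^ (2 * n) * (1 - a) ^ n) = - of_nat (delta q n) -
      (\<Sum>t<3. of_int (rational_term (int q) (int r) (int t)) :: 'a)"
    unfolding q_def by (rule sum_rational[OF q_odd n[unfolded q_def] r[unfolded q_def] n_pos])
  moreover have "artin_trace ([:0, 1:] ^ (2 * n) * [:1, -1:] ^ n) =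
      (\<Sum>t<3. of_int (trace_term (int q) (int r) (int m) (int t)) :: 'a)"
    unfolding q_def
    by (rule artin_trace_shift[OF q_odd n[unfolded q_def] r[unfolded q_def] m[unfolded q_def] n_pos])
  ultimately have "(\<Sum>a\<in>UNIV. a ^ (2 * n) * (1 - a) ^ n) +
      artin_trace ([:0, 1:] ^ (2 * n) * [:1, -1:] ^ n) =
      - of_nat (delta q n) + ((\<Sum>t<3. of_int (trace_term (int q) (int r) (int m) (int t))) -
      (\<Sum>t<3. of_int (rational_term (int q) (int r) (int t))) :: 'a)"
    by simp
  then have cross: "(\<Sum>a\<in>UNIV. a ^ (2 * n) * (1 - a) ^ n) +
      artin_trace ([:0, 1:] ^ (2 * n) * [:1, -1:] ^ n) =
      - of_nat (delta q n) - of_int (sumI (int q) (int u) (int v)) - of_int (sumII (int q) (int u) (int v))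
       + (of_int (sumIII (int q) (int u) (int v)) :: 'a)"
    unfolding edge by simp
  have cube: "(\<Sum>a\<in>UNIV. a ^ (3 * n)) + artin_trace ([:0, 1:] ^ (3 * n)) =
    (if u' + v' * q \<le> q^2 - 2
       then - (inverse (2::'a) ^ (u' + v') * of_nat ((u' + v') choose (q - 1)))
            + of_int (binom_int (2 * (int q - 1) - int u' - int v') (int q - 1 - int u'))
       else -1)"
  proof -
    have uv'_lt: "u' < CARD('a)" "v' < CARD('a)" "0 < u' + v'" using uv' q by (auto simp: q_def)
    have "artin_trace ([:0, 1:] ^ (3 * n)) = artin_trace ([:0, 1:] ^ u' * [:1, -1 :: 'a:] ^ v')"
      by (intro artin_trace_cong cong_X_power_digits q_odd uv'(1))
    \<comment> \<open>In the field, positive exponents matter only modulo \<open>q - 1\<close>,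
      which divides \<open>q^2 - 1\<close>; finally \<open>a^q = a\<close> removes the factor
      \<open>q\<close> at \<open>v'\<close>.\<close>
    moreover have "a ^ (3 * n) = a ^ (u' + v')" for a :: 'a
    proof -
      have "(q - 1) dvd (q\<^sup>2 - 1)"
        using q by (intro dvdI[of _ _ "q + 1"]) (cases q; simp add: power2_eq_square)
      then have "[3 * n = u' + v' * q] (mod (q - 1))"
        using mod_mod_cancel[of "q - 1" "q\<^sup>2 - 1"] uv'(1)[folded q_def]
        unfolding cong_def by metis
      then have "a ^ (3 * n) = a ^ (u' + v' * q)"
        unfolding q_def by (rule power_cong_finite_field) (use n_ge uv'(4) in auto)
      also have "\<dots> = a ^ (u' + v')"
        by (simp add: power_add power_mult mult.commute[of v'] q_def finite_field_power_card)
      finally show ?thesis .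
    qed
    moreover have "of_int (binom_int (2 * (int q - 1) - int u' - int v') (int q - 1 - int u')) =
        (of_nat ((2 * (q - 1) - u' - v') choose (q - 1 - u')) :: 'a)"
    proof -
      have "2 * (int q - 1) - int u' - int v' = int (2 * (q - 1) - u' - v')"
        "int q - 1 - int u' = int (q - 1 - u')"
        using uv'_lt q by (simp_all add: q_def of_nat_diff)
      then show ?thesis by (simp only: binom_int_of_nat of_int_of_nat_eq)
    qed
    ultimately show ?thesis
      using sum_power_plus_artin_trace[OF q_odd uv'_lt] by (simp only: q_def)
  qed
  show ?thesis
    unfolding sum_rev_dickson_cubed[OF q_odd] q_def[symmetric] cross cube by (rule add.commute)
qed

end
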